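(* Let $n\ge 3$, let $s\in(0,1)$ and let $\Omega\subseteq\mathbb{R}^n$ be an arbitrary nonempty open set. Then the optimal constant $\mathcal{S}_{n,s}(\Omega)$ is never achieved: there is no $u\in\mathcal{X}^{1,2}(\Omega)$ with $\|u\|_{L^{2^*}(\mathbb{R}^n)}=1$ and $\rho(u)^2=\mathcal{S}_{n,s}(\Omega)$.
   Context: Let $2^*:=\frac{2n}{n-2}$. For measurable $u:\mathbb{R}^n\to\mathbb{R}$ set $[u]_s:=\Big(\iint_{\mathbb{R}^{2n}}\frac{|u(x)-u(y)|^2}{|x-y|^{n+2s}}\,dx\,dy\Big)^{1/2}$, and $\rho(u):=\big(\|\nabla u\|_{L^2(\mathbb{R}^n)}^2+[u]_s^2\big)^{1/2}$. $\mathcal{X}^{1,2}(\Omega)$ is the completion of $C_0^\infty(\Omega)$ (functions extended by zero to $\mathbb{R}^n$) with respect to the norm $\rho(\cdot)$. By the Sobolev inequality, $\rho$-Cauchy sequences in $C_0^\infty(\Omega)$ are Cauchy in $L^{2^*}(\mathbb{R}^n)$, so $\mathcal{X}^{1,2}(\Omega)$ is regarded as a space of functions $u\in L^{2^*}(\mathbb{R}^n)$ with $u=0$ a.e. in $\mathbb{R}^n\setminus\Omega$, $\nabla u\in L^2(\mathbb{R}^n)$ and $[u]_s<\infty$, with norm $\rho(u)$. $$\mathcal{S}_{n,s}(\Omega):=\inf\{\rho(u)^2: u\in C_0^\infty(\Omega),\ \|u\|_{L^{2^*}(\mathbb{R}^n)}=1\}=\inf\{\rho(u)^2: u\in \mathcal{X}^{1,2}(\Omega),\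 \|u\|_{L^{2^*}(\mathbb{R}^n)}=1\}.$$ *)

theory Defs
  imports "HOL-Analysis.Analysis"
begin

text \<open>
  All norms and energies take values in \<^typ>\<open>ennreal\<close>, so that they make sense, possibly with
  value \<open>\<infinity>\<close>, for every measurable function. Elements of Lebesgue and Sobolev spaces
  are represented by Lebesgue measurable functions, not by their classes modulo null sets.
\<close>

text \<open>Real powers on \<^typ>\<open>ennreal\<close>; only used for exponents \<open>a > 0\<close>.\<close>

definition enn_powr :: "ennreal \<Rightarrow> real \<Rightarrow> ennreal" where
  "enn_powr x a = (if x = \<infinity> then \<infinity> else ennreal (enn2real x powr a))"

definition Lp_norm :: "real \<Rightarrow> ('a::euclidean_space \<Rightarrow> 'b::real_normed_vector) \<Rightarrow> ennreal" where
  "Lp_norm p f = enn_powr (\<integral>\<^sup>+ x. ennreal (norm (f x) powr p) \<partial>lebesgue) (1 / p)"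

primrec C_diff :: "nat \<Rightarrow> ('a::euclidean_space \<Rightarrow> real) \<Rightarrow> bool" where
  "C_diff 0 f \<longleftrightarrow> continuous_on UNIV f"
| "C_diff (Suc k) f \<longleftrightarrow>
     (\<forall>x. f differentiable (at x)) \<and>
     (\<forall>i\<in>Basis. C_diff k (\<lambda>x. frechet_derivative f (at x) i))"

text \<open>\<open>C\<^sub>0\<^sup>\<infinity>(\<Omega>)\<close>: the functions are already extended by zero to the whole space.\<close>

definition test_functions :: "'a::euclidean_space set \<Rightarrow> ('a \<Rightarrow> real) set" where
  "test_functions \<Omega> =
     {\<phi>. (\<forall>k. C_diff k \<phi>) \<and> compact (closure {x. \<phi> x \<noteq> 0}) \<and> closure {x. \<phi> x \<noteq> 0} \<subseteq> \<Omega>}"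

definition locally_integrable ::
    "('a::euclidean_space \<Rightarrow> 'b::{banach, second_countable_topology}) \<Rightarrow> bool" where
  "locally_integrable f \<longleftrightarrow> (\<forall>K. compact K \<longrightarrow> set_integrable lebesgue K f)"

definition is_weak_gradient ::
    "('a::euclidean_space \<Rightarrow> real) \<Rightarrow> ('a \<Rightarrow> 'a) \<Rightarrow> bool" where
  "is_weak_gradient u g \<longleftrightarrow>
     locally_integrable u \<and> locally_integrable g \<and>
     (\<forall>\<phi>\<in>test_functions UNIV. \<forall>i\<in>Basis.
        (LINT x|lebesgue. u x * frechet_derivative \<phi> (at x) i) =
        - (LINT x|lebesgue. (g x \<bullet> i) * \<phi> x))"

text \<open>Weak gradients are unique up to null sets, so the choice below does not affect any norm.\<close>

definition weak_gradient :: "('a::euclidean_space \<Rightarrow> real) \<Rightarrow> 'a \<Rightarrow> 'a" where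
  "weak_gradient u = (SOME g. is_weak_gradient u g)"

definition gradient_norm :: "('a::euclidean_space \<Rightarrow> real) \<Rightarrow> ennreal" where
  "gradient_norm u =
     (if \<exists>g. is_weak_gradient u g then Lp_norm 2 (weak_gradient u) else \<infinity>)"

text \<open>
  The integrand has the value \<open>0\<close> on the diagonal \<open>x = y\<close>, a null set, because
  of the convention \<open>r / 0 = 0\<close>.
\<close>

definition gagliardo_seminorm :: "real \<Rightarrow> ('a::euclidean_space \<Rightarrow> real) \<Rightarrow> ennreal" where
  "gagliardo_seminorm s u =
     enn_powr
       (\<integral>\<^sup>+ (x, y). ennreal (\<bar>u x - u y\<bar>\<^sup>2 / norm (x - y) powr (real DIM('a) + 2 * s))
          \<partial>(lebesgue :: ('a \<times> 'a) measure))
       (1 / 2)"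

definition rho :: "real \<Rightarrow> ('a::euclidean_space \<Rightarrow> real) \<Rightarrow> ennreal" where
  "rho s u = enn_powr ((gradient_norm u)\<^sup>2 + (gagliardo_seminorm s u)\<^sup>2) (1 / 2)"

definition crit_exp :: "nat \<Rightarrow> real" where
  "crit_exp n = 2 * real n / (real n - 2)"

text \<open>
  The completion of \<open>C\<^sub>0\<^sup>\<infinity>(\<Omega>)\<close> with respect to \<^const>\<open>rho\<close>, realised as a space of
  functions: the class of a Cauchy sequence is identified with its limit in the Lebesgue space
  of the critical exponent.
\<close>

definition X12 :: "real \<Rightarrow> 'a::euclidean_space set \<Rightarrow> ('a \<Rightarrow> real) set" where
  "X12 s \<Omega> =
     {u. u \<in> borel_measurable lebesgue \<and> Lp_norm (crit_exp DIM('a)) u < \<infinity> \<and>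
         (\<exists>\<phi>. (\<forall>k::nat. \<phi> k \<in> test_functions \<Omega>) \<and>
              (\<forall>\<epsilon>>0. \<exists>N. \<forall>k\<ge>N. \<forall>m\<ge>N. rho s (\<lambda>x. \<phi> k x - \<phi> m x) < ennreal \<epsilon>) \<and>
              (\<lambda>k. Lp_norm (crit_exp DIM('a)) (\<lambda>x. \<phi> k x - u x)) \<longlonglongrightarrow> 0)}"

definition sobolev_const :: "real \<Rightarrow> 'a::euclidean_space set \<Rightarrow> ennreal" where
  "sobolev_const s \<Omega> =
     Inf {(rho s u)\<^sup>2 | u. u \<in> test_functions \<Omega> \<and> Lp_norm (crit_exp DIM('a)) u = 1}"

end

theory Submission
  imports Defs
begin

text \<open>
  The idea is that concentrating a function near a point makes the nonlocal part of the energy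
  negligible against the local part, so the infimum only sees the local part, whereas a minimiser
  would have to pay for both.

  In detail, replace a test function \<open>\<phi>\<close> on the whole space by \<open>c\<^bsup>(n-2)/2\<^esup> \<phi> (c (x - x0))\<close> with \<open>x0\<close> in
  \<open>\<Omega>\<close>. For large \<open>c\<close> this is a test function on \<open>\<Omega>\<close>; its critical Lebesgue norm and its Dirichlet
  energy do not depend on \<open>c\<close>, but its Gagliardo energy carries the factor \<open>c\<^bsup>2s - 2\<^esup>\<close>, which tends to \<open>0\<close>.
  Hence the constant is at most the Dirichlet energy of \<open>\<phi>\<close> divided by the square of its critical norm
  (\<open>sobolev_const_le_dirichlet_quotient\<close>). For this the Gagliardo energy of a test function must be finite
  (\<open>gagliardo_energy_test_finite\<close>).

  Suppose now that \<open>u\<close> is a minimiser and that the test functions \<open>\<phi>\<^sub>k\<close> approximate it. The limit superior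
  of their Dirichlet energies is at most the squared gradient norm of \<open>u\<close>
  (\<open>dirichlet_energy_eventually_le\<close>) and the limit inferior of their critical norms is at least \<open>1\<close>
  (\<open>power_integral_eventually_ge\<close>). So the constant is at most the squared gradient norm of \<open>u\<close>, while by
  minimality it equals this number plus the Gagliardo energy of \<open>u\<close>. The Gagliardo energy is therefore \<open>0\<close>,
  so \<open>u\<close> is almost everywhere constant (\<open>AE_const_if_gagliardo_energy_zero\<close>), and the critical norm of a
  constant is \<open>0\<close> or \<open>\<infinity>\<close>, not \<open>1\<close>.

  The gradient norm is defined through a weak gradient picked by choice. To compare it with the classical
  gradient of a test function one needs that weak gradients are unique up to null sets
  (\<open>weak_gradient_unique\<close>), and for this that there are enough test functions; they are obtained from
  the flat function \<open>exp (- 1 / t)\<close>.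
\<close>

section \<open>Smooth functions\<close>

abbreviation partial_deriv :: "'a::euclidean_space \<Rightarrow> ('a \<Rightarrow> real) \<Rightarrow> 'a \<Rightarrow> real" where
  "partial_deriv i f \<equiv> (\<lambda>x. frechet_derivative f (at x) i)"

lemma C_diff_SucI:
  assumes "\<And>x. (f has_derivative D x) (at x)"
    and "\<And>i. i \<in> Basis \<Longrightarrow> C_diff k (\<lambda>x. D x i)"
  shows "C_diff (Suc k) f"
proof -
  have "frechet_derivative f (at x) = D x" for x
    using frechet_derivative_at[OF assms(1)[of x]] by simp
  then show ?thesis
    using assms by (auto simp: differentiable_def)
qed

lemma C_diff_has_derivative:
  "C_diff (Suc k) f \<Longrightarrow> (f has_derivative frechet_derivative f (at x)) (at x)"
  by (simp add: frechet_derivative_works)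

lemma C_diff_SucD: "C_diff (Suc k) f \<Longrightarrow> C_diff k f"
proof (induction k arbitrary: f)
  case 0
  then show ?case
    by (auto intro!: differentiable_imp_continuous_on simp: differentiable_on_def
        intro: differentiable_at_withinI)
next
  case (Suc k)
  then show ?case by (meson C_diff.simps(2))
qed

lemma C_diff_const: "C_diff k (\<lambda>x. c)"
proof (induction k arbitrary: c)
  case (Suc k)
  show ?case by (rule C_diff_SucI[of _ "\<lambda>_ _. 0"]) (auto intro: Suc)
qed simp

lemma C_diff_add: "C_diff k f \<Longrightarrow> C_diff k g \<Longrightarrow> C_diff k (\<lambda>x. f x + g x)"
proof (induction k arbitrary: f g)
  case 0
  then show ?case by (simp add: continuous_on_add continuous_on_mult)
next
  case (Suc k)
  show ?case
    by (rule C_diff_SucI, rule has_derivative_add; (rule C_diff_has_derivative, fact)?)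
      (use Suc in auto)
qed

lemma C_diff_mult: "C_diff k f \<Longrightarrow> C_diff k g \<Longrightarrow> C_diff k (\<lambda>x. f x * g x)"
proof (induction k arbitrary: f g)
  case 0
  then show ?case by (simp add: continuous_on_add continuous_on_mult)
next
  case (Suc k)
  show ?case
    by (rule C_diff_SucI, rule has_derivative_mult; (rule C_diff_has_derivative, fact)?)
      (use Suc C_diff_SucD[OF Suc.prems(1)] C_diff_SucD[OF Suc.prems(2)]
        in \<open>auto intro!: C_diff_add\<close>)
qed

lemma C_diff_cmult: "C_diff k f \<Longrightarrow> C_diff k (\<lambda>x. c * f x)"
  by (intro C_diff_mult C_diff_const)

lemma C_diff_diff: "C_diff k f \<Longrightarrow> C_diff k g \<Longrightarrow> C_diff k (\<lambda>x. f x - g x)"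
  using C_diff_add[of k f "\<lambda>x. -1 * g x"] C_diff_cmult[of k g "-1"] by simp

lemma C_diff_prod: "(\<And>i. i \<in> I \<Longrightarrow> C_diff k (f i)) \<Longrightarrow> C_diff k (\<lambda>x. \<Prod>i\<in>I. f i x)"
proof (induction I rule: infinite_finite_induct)
  case (insert i I)
  then show ?case by (simp add: C_diff_mult)
qed (auto simp: C_diff_const)

text \<open>
  The inner derivative is multiplication by the scalar \<open>c\<close>, so linearity of \<open>D\<close> lets it be pulled out.
  In this form the partial derivatives of \<open>f (t + c x)\<close> are again rescaled copies of those of \<open>f\<close>, which
  is what the induction for \<open>C_diff_affine\<close> and all scaling identities below need.
\<close>

lemma has_derivative_affine:
  fixes f :: "'a::euclidean_space \<Rightarrow> real"
  assumes "(f has_derivative D) (at (t + c *\<^sub>R x))"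
  shows "((\<lambda>x. f (t + c *\<^sub>R x)) has_derivative (\<lambda>h. c * D h)) (at x)"
proof -
  have "((\<lambda>x. t + c *\<^sub>R x) has_derivative (\<lambda>h. c *\<^sub>R h)) (at x)"
    by (auto intro!: derivative_eq_intros)
  from diff_chain_at[OF this, of f D] assms
  have "((\<lambda>x. f (t + c *\<^sub>R x)) has_derivative (\<lambda>h. D (c *\<^sub>R h))) (at x)"
    by (simp add: o_def)
  moreover have "linear D" using assms by (rule has_derivative_linear)
  ultimately show ?thesis by (simp add: linear_cmul)
qed

lemma C_diff_affine: "C_diff k f \<Longrightarrow> C_diff k (\<lambda>x. f (t + c *\<^sub>R x))"
proof (induction k arbitrary: f)
  case 0
  then show ?case
    using continuous_on_compose2[of UNIV f UNIV "\<lambda>x. t + c *\<^sub>R x"]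
    by (simp add: continuous_on_add continuous_on_scaleR)
next
  case (Suc k)
  show ?case
    by (rule C_diff_SucI, rule has_derivative_affine, rule C_diff_has_derivative, fact)
      (use Suc in \<open>auto intro!: C_diff_cmult\<close>)
qed

section \<open>Test functions\<close>

text \<open>
  The support is the closure of the set where \<open>\<phi>\<close> does not vanish, but in practice one only knows some
  compact set outside of which \<open>\<phi>\<close> vanishes. This rule and the next one pass between the two descriptions.
\<close>

lemma test_functionsI:
  assumes "\<And>k. C_diff k \<phi>" "compact K" "K \<subseteq> \<Omega>" "\<And>x. x \<notin> K \<Longrightarrow> \<phi> x = 0"
  shows "\<phi> \<in> test_functions \<Omega>"
proof -
  have sub: "closure {x. \<phi> x \<noteq> 0} \<subseteq> K"
    using assms(2,4) by (intro closure_minimal) (auto simp: compact_imp_closed)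
  then have "compact (closure {x. \<phi> x \<noteq> 0})"
    using assms(2) by (meson bounded_subset closed_closure compact_eq_bounded_closed)
  then show ?thesis using assms sub by (auto simp: test_functions_def)
qed

lemma test_functionsE:
  assumes "\<phi> \<in> test_functions \<Omega>"
  obtains K where "compact K" "K \<subseteq> \<Omega>" "\<And>x. x \<notin> K \<Longrightarrow> \<phi> x = 0"
proof
  show "\<phi> x = 0" if "x \<notin> closure {x. \<phi> x \<noteq> 0}" for x
    using that closure_subset[of "{x. \<phi> x \<noteq> 0}"] by auto
qed (use assms in \<open>auto simp: test_functions_def\<close>)

lemma test_C_diff: "\<phi> \<in> test_functions \<Omega> \<Longrightarrow> C_diff k \<phi>"
  by (auto simp: test_functions_def)

lemma test_UNIV: "\<phi> \<in> test_functions \<Omega> \<Longrightarrow> \<phi> \<in> test_functions UNIV"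
  by (auto simp: test_functions_def)

lemma test_continuous: "\<phi> \<in> test_functions \<Omega> \<Longrightarrow> continuous_on UNIV \<phi>"
  using test_C_diff[of \<phi> \<Omega> 0] by simp

lemma test_has_derivative:
  "\<phi> \<in> test_functions \<Omega> \<Longrightarrow> (\<phi> has_derivative frechet_derivative \<phi> (at x)) (at x)"
  by (rule C_diff_has_derivative[of 0]) (rule test_C_diff)

lemma test_partial_deriv:
  assumes "\<phi> \<in> test_functions \<Omega>" "i \<in> Basis"
  shows "partial_deriv i \<phi> \<in> test_functions \<Omega>"
proof -
  obtain K where K: "compact K" "K \<subseteq> \<Omega>" "\<And>x. x \<notin> K \<Longrightarrow> \<phi> x = 0"
    using test_functionsE[OF assms(1)] by blast
  show ?thesis
  proof (rule test_functionsI[OF _ K(1,2)])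
    show "C_diff k (partial_deriv i \<phi>)" for k
      using test_C_diff[OF assms(1), of "Suc k"] assms(2) by simp
    show "partial_deriv i \<phi> x = 0" if "x \<notin> K" for x
    proof -
      have "((\<lambda>x. 0::real) has_derivative (\<lambda>h. 0)) (at x)" by simp
      then have "(\<phi> has_derivative (\<lambda>h. 0)) (at x)"
        by (rule has_derivative_transform_within_open[where s = "- K"])
          (use K that in \<open>auto simp: compact_imp_closed\<close>)
      from frechet_derivative_at[OF this] show ?thesis by metis
    qed
  qed
qed

lemma test_diff:
  assumes "\<phi> \<in> test_functions \<Omega>" "\<psi> \<in> test_functions \<Omega>"
  shows "(\<lambda>x. \<phi> x - \<psi> x) \<in> test_functions \<Omega>"
proof -
  obtain K where K: "compact K" "K \<subseteq> \<Omega>" "\<And>x. x \<notin> K \<Longrightarrow> \<phi> x = 0"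
    using test_functionsE[OF assms(1)] by blast
  obtain L where L: "compact L" "L \<subseteq> \<Omega>" "\<And>x. x \<notin> L \<Longrightarrow> \<psi> x = 0"
    using test_functionsE[OF assms(2)] by blast
  show ?thesis
    by (rule test_functionsI[OF C_diff_diff, OF test_C_diff[OF assms(1)] test_C_diff[OF assms(2)]
          compact_Un[OF K(1) L(1)]]) (use K L in auto)
qed

lemma test_mult:
  assumes "\<phi> \<in> test_functions \<Omega>" "\<And>k. C_diff k f"
  shows "(\<lambda>x. f x * \<phi> x) \<in> test_functions \<Omega>"
proof -
  obtain K where K: "compact K" "K \<subseteq> \<Omega>" "\<And>x. x \<notin> K \<Longrightarrow> \<phi> x = 0"
    using test_functionsE[OF assms(1)] by blast
  show ?thesis
    by (rule test_functionsI[OF C_diff_mult, OF assms(2) test_C_diff[OF assms(1)] K(1,2)])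
      (simp add: K(3))
qed

lemma test_borel_measurable: "\<phi> \<in> test_functions \<Omega> \<Longrightarrow> \<phi> \<in> borel_measurable borel"
  by (intro borel_measurable_continuous_onI test_continuous)

lemma test_bounded:
  assumes "\<phi> \<in> test_functions \<Omega>"
  obtains M where "M > 0" "\<And>x. \<bar>\<phi> x\<bar> \<le> M"
proof -
  obtain K where K: "compact K" "K \<subseteq> \<Omega>" "\<And>x. x \<notin> K \<Longrightarrow> \<phi> x = 0"
    using test_functionsE[OF assms(1)] by blast
  have "compact (\<phi> ` K)"
    using K(1) test_continuous[OF assms] by (blast intro: compact_continuous_image continuous_on_subset)
  then obtain M where "M > 0" "\<forall>y\<in>\<phi> ` K. norm y \<le> M"
    using compact_imp_bounded bounded_pos by metis
  moreover from this have "\<bar>\<phi> x\<bar> \<le> M" for x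
    using K(3)[of x] by (cases "x \<in> K") auto
  ultimately show thesis using that[of M] by blast
qed

lemma test_integrable_power:
  fixes \<phi> :: "'a::euclidean_space \<Rightarrow> real"
  assumes "\<phi> \<in> test_functions \<Omega>" "p > 0"
  shows "integrable lborel (\<lambda>x. \<bar>\<phi> x\<bar> powr p)"
proof -
  obtain K where K: "compact K" "K \<subseteq> \<Omega>" "\<And>x. x \<notin> K \<Longrightarrow> \<phi> x = 0"
    using test_functionsE[OF assms(1)] by blast
  obtain M where M: "M > 0" "\<And>x. \<bar>\<phi> x\<bar> \<le> M" using test_bounded[OF assms(1)] by blast
  have [measurable]: "\<phi> \<in> borel_measurable borel" by (rule test_borel_measurable[OF assms(1)])
  have fin: "emeasure lborel K < \<infinity>" by (intro emeasure_bounded_finite compact_imp_bounded K)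
  show ?thesis
  proof (rule Bochner_Integration.integrable_bound)
    show "integrable lborel (\<lambda>x. indicator K x * M powr p)"
      using fin K(1) by (intro integrable_mult_left integrable_real_indicator)
        (simp_all add: compact_imp_closed)
    show "AE x in lborel. norm (\<bar>\<phi> x\<bar> powr p) \<le> norm (indicator K x * M powr p)"
      using K(3) M assms(2) by (auto simp: indicator_def intro!: powr_mono2)
  qed measurable
qed

lemma test_integrable:
  fixes \<phi> :: "'a::euclidean_space \<Rightarrow> real"
  assumes "\<phi> \<in> test_functions \<Omega>"
  shows "integrable lborel \<phi>"
proof (rule Bochner_Integration.integrable_bound)
  show "integrable lborel (\<lambda>x. \<bar>\<phi> x\<bar> powr 1)" by (rule test_integrable_power[OF assms]) simp
qed (use test_borel_measurable[OF assms] in auto)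

text \<open>
  The partial derivatives are test functions too, hence bounded; they bound the operator norm of the
  derivative, and the mean value inequality applies on the whole space.
\<close>

lemma test_Lipschitz:
  fixes \<phi> :: "'a::euclidean_space \<Rightarrow> real"
  assumes "\<phi> \<in> test_functions \<Omega>"
  obtains L where "L > 0" "\<And>x y. \<bar>\<phi> x - \<phi> y\<bar> \<le> L * norm (x - y)"
proof -
  have "\<exists>M. \<forall>i\<in>Basis. \<forall>x. \<bar>partial_deriv i \<phi> x\<bar> \<le> M i"
  proof (intro bchoice ballI)
    fix i :: 'a assume "i \<in> Basis"
    then show "\<exists>M. \<forall>x. \<bar>partial_deriv i \<phi> x\<bar> \<le> M"
      by (rule test_bounded[OF test_partial_deriv[OF assms]]) blast
  qed
  then obtain M where M: "\<And>i x. i \<in> Basis \<Longrightarrow> \<bar>partial_deriv i \<phi> x\<bar> \<le> M i" by blast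
  define L where "L = (\<Sum>i\<in>Basis. M i)"
  have D: "onorm (frechet_derivative \<phi> (at x)) \<le> L" for x
  proof (rule onorm_le)
    fix v
    let ?D = "frechet_derivative \<phi> (at x)"
    have lin: "linear ?D" by (rule has_derivative_linear[OF test_has_derivative[OF assms]])
    have "?D v = ?D (\<Sum>i\<in>Basis. (v \<bullet> i) *\<^sub>R i)" by (simp add: euclidean_representation)
    also have "\<dots> = (\<Sum>i\<in>Basis. (v \<bullet> i) * ?D i)"
      by (simp add: linear_sum[OF lin] linear_cmul[OF lin])
    also have "norm \<dots> \<le> (\<Sum>i\<in>Basis. norm v * M i)"
      by (intro order.trans[OF norm_sum] sum_mono)
        (auto simp: abs_mult intro!: mult_mono M Basis_le_norm)
    finally show "norm (?D v) \<le> L * norm v" by (simp add: L_def sum_distrib_left mult.commute)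
  qed
  have "norm (\<phi> x - \<phi> y) \<le> L * norm (x - y)" for x y
    by (rule differentiable_bound[of UNIV \<phi> "\<lambda>x. frechet_derivative \<phi> (at x)"])
      (simp_all add: test_has_derivative[OF assms] D)
  then have "\<bar>\<phi> x - \<phi> y\<bar> \<le> (\<bar>L\<bar> + 1) * norm (x - y)" for x y
    using order.trans[OF _ mult_right_mono, of _ L "norm (x - y)" "\<bar>L\<bar> + 1"] by simp
  moreover have "\<bar>L\<bar> + 1 > 0" by simp
  ultimately show thesis using that by blast
qed

section \<open>Bump functions and the fundamental lemma of the calculus of variations\<close>

text \<open>
  The classical flat function \<open>exp (- 1 / t)\<close> together with its products with powers of \<open>1 / t\<close>. The whole
  family is needed because it is closed under differentiation up to linear combinations
  (\<open>flat_exp_deriv\<close>), which turns smoothness into an induction on the order alone.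
\<close>

definition flat_exp :: "nat \<Rightarrow> real \<Rightarrow> real" where
  "flat_exp k t = (if t > 0 then (1 / t) ^ k * exp (- (1 / t)) else 0)"

lemma flat_exp_over_t_tendsto_0: "((\<lambda>t. flat_exp k t / t) \<longlongrightarrow> 0) (at 0)"
proof -
  have "((\<lambda>y::real. y ^ Suc k / exp y) \<longlongrightarrow> 0) at_top"
    by (rule tendsto_power_div_exp_0)
  from filterlim_compose[OF this filterlim_inverse_at_top_right]
  have "((\<lambda>t::real. inverse t ^ Suc k / exp (inverse t)) \<longlongrightarrow> 0) (at_right 0)" .
  then have "((\<lambda>t. flat_exp k t / t) \<longlongrightarrow> 0) (at_right 0)"
    by (rule Lim_transform_eventually)
      (auto simp: flat_exp_def eventually_at_filter exp_minus field_simps)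
  moreover have "((\<lambda>t. flat_exp k t / t) \<longlongrightarrow> 0) (at_left 0)"
    by (rule Lim_transform_eventually[OF tendsto_const])
      (auto simp: flat_exp_def eventually_at_filter)
  ultimately show ?thesis by (simp add: filterlim_split_at)
qed

text \<open>
  Only the origin is not a direct computation; there the difference quotient tends to \<open>0\<close> because
  \<open>y\<^bsup>k + 1\<^esup> / exp y\<close> vanishes as \<open>y = 1 / t\<close> tends to infinity.
\<close>

lemma flat_exp_deriv:
  "(flat_exp k has_real_derivative flat_exp (k + 2) t - real k * flat_exp (Suc k) t) (at t)"
proof -
  consider "t > 0" | "t < 0" | "t = 0" by linarith
  then show ?thesis
  proof cases
    case 1
    have "((\<lambda>t. (1 / t) ^ k * exp (- (1 / t))) has_real_derivative
        flat_exp (k + 2) t - real k * flat_exp (Suc k) t) (at t)"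
    proof -
      have "t ^ k = t * t ^ (k - 1)" if "k \<noteq> 0" using that by (cases k) auto
      then show ?thesis
        using 1 by (cases "k = 0")
          (auto intro!: derivative_eq_intros simp: flat_exp_def field_simps power2_eq_square)
    qed
    then show ?thesis
      by (rule has_field_derivative_transform_within_open[where S = "{0<..}"])
        (use 1 in \<open>auto simp: flat_exp_def\<close>)
  next
    case 2
    have "((\<lambda>t. 0) has_real_derivative 0) (at t)" by simp
    then have "(flat_exp k has_real_derivative 0) (at t)"
      by (rule has_field_derivative_transform_within_open[where S = "{..<0}"])
        (use 2 in \<open>auto simp: flat_exp_def\<close>)
    then show ?thesis using 2 by (simp add: flat_exp_def)
  next
    case 3
    then show ?thesis
      using flat_exp_over_t_tendsto_0[of k]
      by (simp add: has_field_derivative_iff flat_exp_def[of _ 0])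
  qed
qed

lemma C_diff_flat_exp:
  fixes v :: "'a::euclidean_space"
  shows "C_diff j (\<lambda>x. flat_exp k (x \<bullet> v + d))"
proof (induction j arbitrary: k)
  case 0
  have "continuous_on UNIV (flat_exp k)"
    using flat_exp_deriv by (meson DERIV_isCont continuous_at_imp_continuous_on)
  from continuous_on_compose2[OF this, of UNIV "\<lambda>x. x \<bullet> v + d"]
  show ?case by (simp add: continuous_on_add continuous_on_inner)
next
  case (Suc j)
  let ?D = "\<lambda>t. flat_exp (k + 2) t - real k * flat_exp (Suc k) t"
  show ?case
  proof (rule C_diff_SucI)
    fix x
    have "(flat_exp k has_derivative (\<lambda>h. h * ?D (x \<bullet> v + d))) (at (x \<bullet> v + d))"
      using flat_exp_deriv[of k "x \<bullet> v + d"]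
      unfolding has_field_derivative_def
      by (rule has_derivative_eq_rhs) (simp add: fun_eq_iff mult.commute)
    moreover have "((\<lambda>x. x \<bullet> v + d) has_derivative (\<lambda>h. h \<bullet> v)) (at x)"
      by (auto intro!: derivative_eq_intros)
    ultimately show "((\<lambda>x. flat_exp k (x \<bullet> v + d)) has_derivative (\<lambda>h. (h \<bullet> v) * ?D (x \<bullet> v + d))) (at x)"
      using diff_chain_at[of "\<lambda>x. x \<bullet> v + d" "\<lambda>h. h \<bullet> v" x "flat_exp k"] by (simp add: o_def)
  next
    show "C_diff j (\<lambda>x. i \<bullet> v * ?D (x \<bullet> v + d))" if "i \<in> Basis" for i
      by (intro C_diff_cmult C_diff_diff Suc.IH)
  qed
qed

text \<open>
  In every coordinate direction, \<open>flat_exp 0\<close> of the distances to the two faces of the box, each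
  magnified by \<open>m + 1\<close>. Since \<open>flat_exp 0 (m t) = (flat_exp 0 t)\<^bsup>1/m\<^esup>\<close> tends to the indicator of \<open>t > 0\<close>,
  these smooth functions converge pointwise to the indicator of the open box.
\<close>

definition box_bump :: "'a::euclidean_space \<Rightarrow> 'a \<Rightarrow> nat \<Rightarrow> 'a \<Rightarrow> real" where
  "box_bump a b m x =
     (\<Prod>i\<in>Basis. flat_exp 0 (real (Suc m) * ((x - a) \<bullet> i)) * flat_exp 0 (real (Suc m) * ((b - x) \<bullet> i)))"

lemma flat_exp_0_bounds: "0 \<le> flat_exp 0 t" "flat_exp 0 t \<le> 1"
  by (auto simp: flat_exp_def)

lemma flat_exp_0_tendsto:
  "(\<lambda>m. flat_exp 0 (real (Suc m) * t)) \<longlonglongrightarrow> (if t > 0 then 1 else 0)"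
proof (cases "t > 0")
  case True
  have "filterlim (\<lambda>m. t * real (Suc m)) at_top sequentially"
    by (rule filterlim_tendsto_pos_mult_at_top[OF tendsto_const True])
      (rule filterlim_compose[OF filterlim_real_sequentially filterlim_Suc])
  then have "(\<lambda>m. exp (- inverse (t * real (Suc m)))) \<longlonglongrightarrow> exp (- 0)"
    by (intro tendsto_exp tendsto_minus tendsto_inverse_0_at_top)
  moreover have "flat_exp 0 (real (Suc m) * t) = exp (- inverse (t * real (Suc m)))" for m
    using True by (simp add: flat_exp_def inverse_eq_divide mult.commute del: of_nat_Suc)
  ultimately show ?thesis
    using True by simp
next
  case False
  then have "flat_exp 0 (real (Suc m) * t) = 0" for m
    by (simp add: flat_exp_def mult_le_0_iff not_less flip: of_nat_Suc)
  then show ?thesis using False by simp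
qed

lemma box_bump_bounds: "0 \<le> box_bump a b m x" "box_bump a b m x \<le> 1"
  unfolding box_bump_def
  by (auto intro!: prod_nonneg prod_le_1 mult_le_one simp: flat_exp_0_bounds)

lemma box_bump_eq_0: "x \<notin> box a b \<Longrightarrow> box_bump a b m x = 0"
proof -
  assume "x \<notin> box a b"
  then obtain i where i: "i \<in> Basis" "(x - a) \<bullet> i \<le> 0 \<or> (b - x) \<bullet> i \<le> 0"
    by (force simp: mem_box inner_diff_left)
  then have "real (Suc m) * ((x - a) \<bullet> i) \<le> 0 \<or> real (Suc m) * ((b - x) \<bullet> i) \<le> 0"
    by (simp only: mult_le_0_iff) simp
  then have "flat_exp 0 (real (Suc m) * ((x - a) \<bullet> i)) * flat_exp 0 (real (Suc m) * ((b - x) \<bullet> i)) = 0"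
    by (auto simp: flat_exp_def simp del: of_nat_Suc)
  then show ?thesis using i(1) by (auto simp: box_bump_def)
qed

lemma box_bump_tendsto: "(\<lambda>m. box_bump a b m x) \<longlonglongrightarrow> indicator (box a b) x"
proof -
  let ?P = "\<Prod>i\<in>Basis. (if (x - a) \<bullet> i > 0 then 1 else 0 :: real) * (if (b - x) \<bullet> i > 0 then 1 else 0)"
  have "(\<lambda>m. box_bump a b m x) \<longlonglongrightarrow> ?P"
    unfolding box_bump_def by (intro tendsto_prod tendsto_mult flat_exp_0_tendsto)
  moreover have "?P = indicator (box a b) x"
  proof (cases "x \<in> box a b")
    case True
    then show ?thesis by (auto simp: mem_box inner_diff_left intro!: prod.neutral)
  next
    case False
    then show ?thesis by (force simp: mem_box inner_diff_left)
  qed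
  ultimately show ?thesis by simp
qed

lemma box_bump_test: "box_bump a b m \<in> test_functions UNIV"
proof (rule test_functionsI[of _ "cbox a b"])
  fix k
  have *: "real (Suc m) * ((x - a) \<bullet> i) = x \<bullet> (real (Suc m) *\<^sub>R i) + - real (Suc m) * (a \<bullet> i)"
    "real (Suc m) * ((b - x) \<bullet> i) = x \<bullet> (- real (Suc m) *\<^sub>R i) + real (Suc m) * (b \<bullet> i)" for x i :: 'a
    by (simp_all add: algebra_simps)
  show "C_diff k (box_bump a b m)"
    unfolding box_bump_def[abs_def] * by (intro C_diff_prod C_diff_mult C_diff_flat_exp)
qed (use box_subset_cbox[of a b] in \<open>auto intro!: box_bump_eq_0\<close>)

text \<open>
  The Borel sets over which \<open>f\<close> integrates to \<open>0\<close> form a Dynkin system: the whole space belongs to it as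
  an increasing union of boxes, and complements and disjoint unions follow from additivity. Boxes are
  stable under intersection and generate the Borel sets, so every Borel set belongs to it.
\<close>

lemma AE_zero_if_integral_box_zero:
  fixes f :: "'a::euclidean_space \<Rightarrow> real"
  assumes f: "integrable lborel f"
    and box: "\<And>a b. (LINT x:box a b|lborel. f x) = 0"
  shows "AE x in lborel. f x = 0"
proof (rule sigma_finite_measure.density_zero[OF lborel.sigma_finite_measure_axioms f])
  have [measurable]: "f \<in> borel_measurable borel" using f by simp
  have int: "set_integrable lborel A f" if "A \<in> sets borel" for A
    using integrable_mult_indicator[OF _ f, of A] that by (simp add: set_integrable_def)
  let ?B = "\<lambda>i::nat. box (- (real i *\<^sub>R One)) (real i *\<^sub>R One) :: 'a set"
  have "incseq ?B"
    by (auto simp: incseq_def mem_box) (smt (verit) of_nat_mono)+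
  then have "(\<lambda>i. LINT x:?B i|lborel. f x) \<longlonglongrightarrow> (LINT x:(\<Union>i. ?B i)|lborel. f x)"
    by (intro set_integral_cont_up int) auto
  then have all: "(LINT x|lborel. f x) = 0"
    unfolding UN_box_eq_UNIV box LIMSEQ_const_iff by (simp add: set_lebesgue_integral_def)
  fix A :: "'a set" assume "A \<in> sets lborel"
  then have A: "A \<in> sigma_sets UNIV (range (\<lambda>(a, b). box a b))" by (simp add: borel_eq_box)
  have "Int_stable (range (\<lambda>(a, b). box a b :: 'a set))"
    by (auto simp: Int_stable_def box_Int_box)
  from this subset_UNIV[of "range (\<lambda>(a, b). box a b :: 'a set)", folded Pow_UNIV] A
  have "A \<in> sets borel \<and> (LINT x:A|lborel. f x) = 0"
  proof (induction rule: sigma_sets_induct_disjoint)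
    case (basic A)
    then show ?case by (auto simp: box)
  next
    case empty
    then show ?case by (simp add: set_lebesgue_integral_def)
  next
    case (compl A)
    have "(LINT x:A \<union> (UNIV - A)|lborel. f x) = (LINT x:A|lborel. f x) + (LINT x:UNIV - A|lborel. f x)"
      using compl by (intro set_integral_Un int) auto
    moreover have "(LINT x:A \<union> (UNIV - A)|lborel. f x) = 0"
      using all by (simp add: set_lebesgue_integral_def)
    ultimately show ?case using compl by auto
  next
    case (union A)
    then have A: "\<And>i. A i \<in> sets borel" "\<And>i. (LINT x:A i|lborel. f x) = 0" by auto
    have "(LINT x:(\<Union>i. A i)|lborel. f x) = (\<Sum>i. LINT x:A i|lborel. f x)"
      using union(1) A(1) by (intro lebesgue_integral_countable_add int)
        (auto simp: disjoint_family_on_def)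
    then show ?case using A by auto
  qed
  then show "(LINT x:A|lborel. f x) = 0" ..
qed

lemma borel_measurable_lebesgue_if_borel:
  "f \<in> borel_measurable borel \<Longrightarrow> f \<in> borel_measurable lebesgue"
  by (rule measurable_completion) simp

lemma locally_integrable_measurable:
  fixes f :: "'a::euclidean_space \<Rightarrow> 'b::{banach, second_countable_topology}"
  assumes "locally_integrable f"
  shows "f \<in> borel_measurable lebesgue"
proof (rule borel_measurable_LIMSEQ_metric)
  show "(\<lambda>x. indicator (cball 0 (real n)) x *\<^sub>R f x) \<in> borel_measurable lebesgue" for n :: nat
    using assms unfolding locally_integrable_def set_integrable_def
    by (intro borel_measurable_integrable) simp
  show "(\<lambda>n. indicator (cball 0 (real n)) x *\<^sub>R f x) \<longlonglongrightarrow> f x" for x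
  proof (rule tendsto_eventually)
    obtain N :: nat where "norm x \<le> real N" using real_arch_simple by blast
    then show "\<forall>\<^sub>F n in sequentially. indicator (cball 0 (real n)) x *\<^sub>R f x = f x"
      by (intro eventually_sequentiallyI[of N]) (auto simp: indicator_def)
  qed
qed

text \<open>
  The fundamental lemma of the calculus of variations. Testing with \<open>box_bump\<close> and letting the bumps
  converge to the indicator of a box shows that \<open>h\<close> integrates to \<open>0\<close> over every box. The preceding
  criterion is about Borel functions that are integrable on the whole space, so it is applied to a
  Borel version of \<open>h\<close> cut off to larger and larger boxes.
\<close>

lemma AE_zero_if_test_integrals_zero:
  fixes h :: "'a::euclidean_space \<Rightarrow> real"
  assumes h: "locally_integrable h"
    and zero: "\<And>\<psi>. \<psi> \<in> test_functions UNIV \<Longrightarrow> (LINT x|lebesgue. h x * \<psi> x) = 0"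
  shows "AE x in lebesgue. h x = 0"
proof -
  have h_meas: "h \<in> borel_measurable lebesgue" by (rule locally_integrable_measurable[OF h])
  have int: "set_integrable lebesgue (box a b) h" for a b
    using h[unfolded locally_integrable_def, rule_format, of "cbox a b"]
    by (rule set_integrable_subset) (auto simp: box_subset_cbox compact_cbox)
  have box: "(LINT x:box a b|lebesgue. h x) = 0" for a b
  proof -
    have "(\<lambda>m. LINT x|lebesgue. h x * box_bump a b m x) \<longlonglongrightarrow> (LINT x|lebesgue. h x * indicator (box a b) x)"
    proof (rule integral_dominated_convergence)
      show "integrable lebesgue (\<lambda>x. norm (indicator (box a b) x *\<^sub>R h x))"
        using int[of a b] unfolding set_integrable_def by (rule integrable_norm)
      show "AE x in lebesgue. (\<lambda>m. h x * box_bump a b m x) \<longlonglongrightarrow> h x * indicator (box a b) x"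
        by (intro AE_I2 tendsto_mult tendsto_const box_bump_tendsto)
      show "AE x in lebesgue. norm (h x * box_bump a b m x) \<le> norm (indicator (box a b) x *\<^sub>R h x)" for m
        using box_bump_bounds[of a b m] box_bump_eq_0[of _ a b m]
        by (intro AE_I2) (auto simp: abs_mult indicator_def intro: mult_left_le)
      show "(\<lambda>x. h x * box_bump a b m x) \<in> borel_measurable lebesgue" for m
        by (rule borel_measurable_times[OF h_meas borel_measurable_lebesgue_if_borel])
          (rule test_borel_measurable[OF box_bump_test])
      show "(\<lambda>x. h x * indicator (box a b) x) \<in> borel_measurable lebesgue"
        by (rule borel_measurable_times[OF h_meas borel_measurable_lebesgue_if_borel]) simp
    qed
    then show ?thesis
      by (simp add: zero box_bump_test LIMSEQ_const_iff set_lebesgue_integral_def mult.commute)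
  qed
  obtain h' where h'[measurable]: "h' \<in> borel_measurable lborel" and eq: "AE x in lborel. h x = h' x"
    using completion_ex_borel_measurable_real[of h lborel] h_meas by auto
  note eq' = AE_completion[OF eq]
  define B where "B = (\<lambda>n::nat. box (- (real n *\<^sub>R One)) (real n *\<^sub>R One) :: 'a set)"
  have "AE x in lborel. indicator (B n) x * h' x = 0" for n
  proof (rule AE_zero_if_integral_box_zero)
    have "integrable lebesgue (\<lambda>x. indicator (B n) x *\<^sub>R h' x)"
    proof (rule integrable_cong_AE_imp)
      show "integrable lebesgue (\<lambda>x. indicator (B n) x *\<^sub>R h x)"
        using int unfolding set_integrable_def B_def by blast
      show "AE x in lebesgue. indicator (B n) x *\<^sub>R h x = indicator (B n) x *\<^sub>R h' x"
        using eq' by eventually_elim simp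
      show "(\<lambda>x. indicator (B n) x *\<^sub>R h' x) \<in> borel_measurable lebesgue"
        unfolding B_def by (rule borel_measurable_lebesgue_if_borel) measurable
    qed
    then show "integrable lborel (\<lambda>x. indicator (B n) x * h' x)"
      by (simp add: integrable_completion B_def)
    fix a b
    obtain c d where cd: "box a b \<inter> B n = box c d"
      unfolding B_def box_Int_box by blast
    have "(LINT x:box a b|lborel. indicator (B n) x * h' x) = (LINT x|lborel. indicator (box c d) x *\<^sub>R h' x)"
      unfolding set_lebesgue_integral_def cd[symmetric]
      by (intro Bochner_Integration.integral_cong) (auto simp: indicator_def)
    also have "\<dots> = (LINT x|lebesgue. indicator (box c d) x *\<^sub>R h' x)"
      by (simp add: integral_completion)
    also have "\<dots> = (LINT x:box c d|lebesgue. h x)"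
      unfolding set_lebesgue_integral_def
    proof (rule integral_cong_AE)
      show "AE x in lebesgue. indicator (box c d) x *\<^sub>R h' x = indicator (box c d) x *\<^sub>R h x"
        using eq' by eventually_elim simp
      show "(\<lambda>x. indicator (box c d) x *\<^sub>R h' x) \<in> borel_measurable lebesgue"
        by (rule borel_measurable_lebesgue_if_borel) measurable
      show "(\<lambda>x. indicator (box c d) x *\<^sub>R h x) \<in> borel_measurable lebesgue"
        by (rule borel_measurable_scaleR[OF borel_measurable_lebesgue_if_borel h_meas]) simp
    qed
    finally show "(LINT x:box a b|lborel. indicator (B n) x * h' x) = 0" using box by simp
  qed
  then have "AE x in lborel. \<forall>n. indicator (B n) x * h' x = 0"
    unfolding AE_all_countable ..
  moreover have "\<exists>n. x \<in> B n" for x :: 'a using UN_box_eq_UNIV unfolding B_def by blast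
  ultimately have "AE x in lborel. h' x = 0"
    by (auto elim!: eventually_mono simp: indicator_def split: if_splits)
  with eq have "AE x in lborel. h x = 0" by eventually_elim simp
  then show ?thesis by (rule AE_completion)
qed

section \<open>The weak gradient of a test function\<close>

lemma integral_lborel_translate:
  fixes f :: "'a::euclidean_space \<Rightarrow> real"
  assumes [measurable]: "f \<in> borel_measurable borel"
  shows "(LINT x|lborel. f (a + x)) = (LINT x|lborel. f x)"
  by (subst (2) lborel_distr_plus[of a, symmetric]) (simp add: integral_distr)

lemma integrable_lborel_translate:
  fixes f :: "'a::euclidean_space \<Rightarrow> real"
  assumes "integrable lborel f"
  shows "integrable lborel (\<lambda>x. f (a + x))"
  using assms
  by (intro integrable_distr[of "(+) a" lborel borel]) (simp_all add: lborel_distr_plus)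

text \<open>
  The difference quotients \<open>(\<phi> (x + h i) - \<phi> x) / h\<close> have integral \<open>0\<close> by translation invariance. They
  converge to the partial derivative and, since \<open>\<phi>\<close> is Lipschitz with compact support, they are
  dominated by a multiple of the indicator of a fixed ball.
\<close>

lemma integral_partial_deriv:
  fixes \<phi> :: "'a::euclidean_space \<Rightarrow> real"
  assumes \<phi>: "\<phi> \<in> test_functions \<Omega>" and i: "i \<in> Basis"
  shows "(LINT x|lborel. partial_deriv i \<phi> x) = 0"
proof -
  define h where "h m = inverse (real (Suc m))" for m
  have h: "h m > 0" "h m \<le> 1" for m by (auto simp: h_def divide_simps)
  have h0: "filterlim h (at 0) sequentially"
    unfolding filterlim_at using h
    by (auto simp: h_def[abs_def] LIMSEQ_inverse_real_of_nat simp del: of_nat_Suc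
        intro!: always_eventually)
  obtain L where L: "L > 0" "\<And>x y. \<bar>\<phi> x - \<phi> y\<bar> \<le> L * norm (x - y)"
    using test_Lipschitz[OF \<phi>] by blast
  obtain K where K: "compact K" "K \<subseteq> \<Omega>" "\<And>x. x \<notin> K \<Longrightarrow> \<phi> x = 0"
    using test_functionsE[OF \<phi>] by blast
  obtain R where R: "\<And>x. x \<in> K \<Longrightarrow> norm x \<le> R"
    using compact_imp_bounded[OF K(1)] unfolding bounded_iff by blast
  have [measurable]: "\<phi> \<in> borel_measurable borel" by (rule test_borel_measurable[OF \<phi>])
  have [measurable]: "partial_deriv i \<phi> \<in> borel_measurable borel"
    by (rule test_borel_measurable[OF test_partial_deriv[OF \<phi> i]])
  have "(\<lambda>m. LINT x|lborel. (\<phi> (h m *\<^sub>R i + x) - \<phi> x) / h m) \<longlonglongrightarrow> (LINT x|lborel. partial_deriv i \<phi> x)"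
  proof (rule integral_dominated_convergence)
    show "integrable lborel (\<lambda>x::'a. L * indicator (cball 0 (R + 1)) x)"
      using emeasure_bounded_finite[OF bounded_cball, of "0::'a" "R + 1"]
      by (intro integrable_mult_right integrable_real_indicator) simp_all
    show "AE x in lborel. (\<lambda>m. (\<phi> (h m *\<^sub>R i + x) - \<phi> x) / h m) \<longlonglongrightarrow> partial_deriv i \<phi> x"
    proof (rule AE_I2)
      fix x
      have "((\<lambda>t. x + t *\<^sub>R i) has_derivative (\<lambda>t. t *\<^sub>R i)) (at 0)"
        by (auto intro!: derivative_eq_intros)
      from diff_chain_at[OF this, of \<phi> "frechet_derivative \<phi> (at x)"] test_has_derivative[OF \<phi>, of x]
      have "((\<lambda>t. \<phi> (x + t *\<^sub>R i)) has_derivative (\<lambda>t. frechet_derivative \<phi> (at x) (t *\<^sub>R i))) (at 0)"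
        by (simp add: o_def)
      moreover have "linear (frechet_derivative \<phi> (at x))"
        by (rule has_derivative_linear[OF test_has_derivative[OF \<phi>]])
      ultimately have "((\<lambda>t. \<phi> (x + t *\<^sub>R i)) has_real_derivative partial_deriv i \<phi> x) (at 0)"
        by (simp add: has_field_derivative_def linear_cmul mult_commute_abs)
      then have "((\<lambda>t. (\<phi> (x + t *\<^sub>R i) - \<phi> x) / t) \<longlongrightarrow> partial_deriv i \<phi> x) (at 0)"
        by (simp add: has_field_derivative_iff)
      from filterlim_compose[OF this h0]
      show "(\<lambda>m. (\<phi> (h m *\<^sub>R i + x) - \<phi> x) / h m) \<longlonglongrightarrow> partial_deriv i \<phi> x"
        by (simp add: add.commute)
    qed
    show "AE x in lborel. norm ((\<phi> (h m *\<^sub>R i + x) - \<phi> x) / h m) \<le> L * indicator (cball 0 (R + 1)) x" for m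
    proof (rule AE_I2)
      fix x
      show "norm ((\<phi> (h m *\<^sub>R i + x) - \<phi> x) / h m) \<le> L * indicator (cball 0 (R + 1)) x"
      proof (cases "norm x \<le> R + 1")
        case True
        have "\<bar>\<phi> (h m *\<^sub>R i + x) - \<phi> x\<bar> \<le> L * h m"
          using L(2)[of "h m *\<^sub>R i + x" x] i h(1)[of m] by simp
        then show ?thesis using True h(1)[of m] by (simp add: abs_div divide_simps)
      next
        case False
        have "norm (h m *\<^sub>R i + x) \<ge> norm x - h m"
          using norm_triangle_ineq2[of x "- (h m *\<^sub>R i)"] i h(1)[of m] by (simp add: add.commute)
        then have "norm (h m *\<^sub>R i + x) > R" "norm x > R" using False h(2)[of m] by auto
        then have "\<phi> (h m *\<^sub>R i + x) = 0" "\<phi> x = 0"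
          using K(3) R[of x] R[of "h m *\<^sub>R i + x"] by fastforce+
        then show ?thesis using L by simp
      qed
    qed
  qed measurable
  moreover have "(LINT x|lborel. (\<phi> (h m *\<^sub>R i + x) - \<phi> x) / h m) = 0" for m
    using test_integrable[OF \<phi>]
    by (simp add: integral_lborel_translate integrable_lborel_translate)
  ultimately show ?thesis by (simp only: LIMSEQ_const_iff)
qed

definition gradient :: "('a::euclidean_space \<Rightarrow> real) \<Rightarrow> 'a \<Rightarrow> 'a" where
  "gradient \<phi> x = (\<Sum>i\<in>Basis. partial_deriv i \<phi> x *\<^sub>R i)"

lemma gradient_inner: "i \<in> Basis \<Longrightarrow> gradient \<phi> x \<bullet> i = partial_deriv i \<phi> x"
  by (simp add: gradient_def)

lemma gradient_continuous: "\<phi> \<in> test_functions \<Omega> \<Longrightarrow> continuous_on UNIV (gradient \<phi>)"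
  unfolding gradient_def[abs_def]
  by (intro continuous_on_sum continuous_on_scaleR continuous_on_const
      test_continuous[OF test_partial_deriv])

lemma continuous_locally_integrable:
  fixes f :: "'a::euclidean_space \<Rightarrow> 'b::{banach, second_countable_topology}"
  assumes "continuous_on UNIV f"
  shows "locally_integrable f"
  unfolding locally_integrable_def set_integrable_def
proof (intro allI impI)
  fix K :: "'a set" assume "compact K"
  then have "integrable lborel (\<lambda>x. indicator K x *\<^sub>R f x)"
    by (rule borel_integrable_compact) (rule continuous_on_subset[OF assms subset_UNIV])
  then show "integrable lebesgue (\<lambda>x. indicator K x *\<^sub>R f x)"
    by (simp add: integrable_completion)
qed

lemma test_mult_integrable:
  fixes \<phi> \<psi> :: "'a::euclidean_space \<Rightarrow> real"
  assumes "\<phi> \<in> test_functions \<Omega>" "\<psi> \<in> test_functions \<Omega>'"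
  shows "integrable lborel (\<lambda>x. \<phi> x * \<psi> x)"
  by (rule test_integrable[OF test_mult[OF assms(2) test_C_diff[OF assms(1)]]])

text \<open>
  The product \<open>\<phi> \<psi>\<close> is a test function, so its partial derivative has integral \<open>0\<close>.
\<close>

lemma integral_by_parts:
  fixes \<phi> \<psi> :: "'a::euclidean_space \<Rightarrow> real"
  assumes \<phi>: "\<phi> \<in> test_functions \<Omega>" and \<psi>: "\<psi> \<in> test_functions \<Omega>'" and i: "i \<in> Basis"
  shows "(LINT x|lborel. \<phi> x * partial_deriv i \<psi> x) = - (LINT x|lborel. partial_deriv i \<phi> x * \<psi> x)"
proof -
  have "partial_deriv i (\<lambda>x. \<phi> x * \<psi> x) x = \<phi> x * partial_deriv i \<psi> x + partial_deriv i \<phi> x * \<psi> x" for x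
    using frechet_derivative_at[OF has_derivative_mult[OF test_has_derivative[OF \<phi>, of x]
          test_has_derivative[OF \<psi>, of x]], symmetric]
    by simp
  then have "(LINT x|lborel. \<phi> x * partial_deriv i \<psi> x + partial_deriv i \<phi> x * \<psi> x) = 0"
    using integral_partial_deriv[OF test_mult[OF \<psi> test_C_diff[OF \<phi>]] i] by simp
  then show ?thesis
    using test_mult_integrable[OF \<phi> test_partial_deriv[OF \<psi> i]]
      test_mult_integrable[OF test_partial_deriv[OF \<phi> i] \<psi>] by simp
qed

lemma gradient_is_weak_gradient:
  assumes \<phi>: "\<phi> \<in> test_functions \<Omega>"
  shows "is_weak_gradient \<phi> (gradient \<phi>)"
  unfolding is_weak_gradient_def
proof (intro conjI ballI)
  show "locally_integrable \<phi>" "locally_integrable (gradient \<phi>)"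
    by (intro continuous_locally_integrable test_continuous[OF \<phi>] gradient_continuous[OF \<phi>])+
  fix \<psi> :: "'a \<Rightarrow> real" and i :: 'a
  assume \<psi>: "\<psi> \<in> test_functions UNIV" and i: "i \<in> Basis"
  have m: "\<phi> \<in> borel_measurable borel" "\<psi> \<in> borel_measurable borel"
    "partial_deriv i \<phi> \<in> borel_measurable borel" "partial_deriv i \<psi> \<in> borel_measurable borel"
    by (rule test_borel_measurable[OF \<phi>] test_borel_measurable[OF \<psi>]
        test_borel_measurable[OF test_partial_deriv[OF \<phi> i]] test_borel_measurable[OF test_partial_deriv[OF \<psi> i]])+
  show "(LINT x|lebesgue. \<phi> x * partial_deriv i \<psi> x) = - (LINT x|lebesgue. gradient \<phi> x \<bullet> i * \<psi> x)"
    using integral_by_parts[OF \<phi> \<psi> i] i m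
    by (simp add: gradient_inner integral_completion)
qed

lemma locally_integrable_mult_test:
  fixes f \<psi> :: "'a::euclidean_space \<Rightarrow> real"
  assumes f: "locally_integrable f" and \<psi>: "\<psi> \<in> test_functions \<Omega>"
  shows "integrable lebesgue (\<lambda>x. f x * \<psi> x)"
proof -
  obtain K where K: "compact K" "K \<subseteq> \<Omega>" "\<And>x. x \<notin> K \<Longrightarrow> \<psi> x = 0"
    using test_functionsE[OF \<psi>] by blast
  obtain M where M: "\<And>x. \<bar>\<psi> x\<bar> \<le> M" using test_bounded[OF \<psi>] by blast
  have \<psi>m: "\<psi> \<in> borel_measurable lebesgue"
    by (rule borel_measurable_lebesgue_if_borel[OF test_borel_measurable[OF \<psi>]])
  have int: "integrable lebesgue (\<lambda>x. M * (indicator K x *\<^sub>R f x))"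
    using f K(1) unfolding locally_integrable_def set_integrable_def by (intro integrable_mult_right) blast
  show ?thesis
  proof (rule Bochner_Integration.integrable_bound[OF int])
    show "(\<lambda>x. f x * \<psi> x) \<in> borel_measurable lebesgue"
      by (rule borel_measurable_times[OF locally_integrable_measurable[OF f] \<psi>m])
    have "norm (f x * \<psi> x) \<le> norm (M * (indicator K x *\<^sub>R f x))" for x
      using K(3)[of x] mult_right_mono[OF M[of x], of "\<bar>f x\<bar>"] M[of x]
      by (cases "x \<in> K") (auto simp: abs_mult mult.commute)
    then show "AE x in lebesgue. norm (f x * \<psi> x) \<le> norm (M * (indicator K x *\<^sub>R f x))"
      by (rule AE_I2)
  qed
qed

lemma weak_gradient_component_locally_integrable:
  fixes g :: "'a::euclidean_space \<Rightarrow> 'a"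
  assumes "locally_integrable g"
  shows "locally_integrable (\<lambda>x. g x \<bullet> i)"
  using assms integrable_inner_left[of i lebesgue "\<lambda>x. indicator K x *\<^sub>R g x" for K]
  by (auto simp: locally_integrable_def set_integrable_def)

text \<open>
  This is what makes the norm of the chosen weak gradient computable: whichever weak gradient is
  picked, it agrees with any given one almost everywhere.
\<close>

lemma weak_gradient_unique:
  fixes u :: "'a::euclidean_space \<Rightarrow> real"
  assumes g: "is_weak_gradient u g" and g': "is_weak_gradient u g'"
  shows "AE x in lebesgue. g x = g' x"
proof -
  have "AE x in lebesgue. g x \<bullet> i - g' x \<bullet> i = 0" if i: "i \<in> Basis" for i
  proof (rule AE_zero_if_test_integrals_zero)
    have loc: "locally_integrable (\<lambda>x. g x \<bullet> i)" "locally_integrable (\<lambda>x. g' x \<bullet> i)"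
      using g g' by (auto simp: is_weak_gradient_def intro: weak_gradient_component_locally_integrable)
    then show "locally_integrable (\<lambda>x. g x \<bullet> i - g' x \<bullet> i)"
      by (auto simp: locally_integrable_def intro!: set_integral_diff)
    fix \<psi> :: "'a \<Rightarrow> real" assume \<psi>: "\<psi> \<in> test_functions UNIV"
    show "(LINT x|lebesgue. (g x \<bullet> i - g' x \<bullet> i) * \<psi> x) = 0"
      using locally_integrable_mult_test[OF loc(1) \<psi>] locally_integrable_mult_test[OF loc(2) \<psi>] g g' \<psi> i
      by (simp add: left_diff_distrib is_weak_gradient_def)
  qed
  then have "AE x in lebesgue. \<forall>i\<in>Basis. g x \<bullet> i - g' x \<bullet> i = 0"
    by (simp add: AE_finite_all)
  then show ?thesis by eventually_elim (auto intro: euclidean_eqI)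
qed

lemma enn_powr_half_square: "(enn_powr x (1 / 2))\<^sup>2 = x"
proof (cases x)
  case (real r)
  then show ?thesis
    by (simp add: enn_powr_def powr_half_sqrt ennreal_power)
qed (simp add: enn_powr_def)

lemma gradient_norm_test:
  fixes \<phi> :: "'a::euclidean_space \<Rightarrow> real"
  assumes \<phi>: "\<phi> \<in> test_functions \<Omega>"
  shows "(gradient_norm \<phi>)\<^sup>2 = (\<integral>\<^sup>+x. ennreal ((norm (gradient \<phi> x))\<^sup>2) \<partial>lborel)"
proof -
  note w = gradient_is_weak_gradient[OF \<phi>]
  then have "is_weak_gradient \<phi> (weak_gradient \<phi>)" unfolding weak_gradient_def by (rule someI[of "is_weak_gradient \<phi>"])
  from weak_gradient_unique[OF this w]
  have "(\<integral>\<^sup>+x. ennreal (norm (weak_gradient \<phi> x) powr 2) \<partial>lebesgue) =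
      (\<integral>\<^sup>+x. ennreal ((norm (gradient \<phi> x))\<^sup>2) \<partial>lebesgue)"
    by (intro nn_integral_cong_AE) (auto elim!: eventually_mono simp: powr_numeral)
  then show ?thesis
    using w by (auto simp: gradient_norm_def Lp_norm_def enn_powr_half_square nn_integral_completion)
qed

section \<open>Finiteness of the Gagliardo energy of test functions\<close>

lemma nn_integral_lborel_translate:
  fixes f :: "'a::euclidean_space \<Rightarrow> ennreal"
  assumes [measurable]: "f \<in> borel_measurable borel"
  shows "(\<integral>\<^sup>+x. f (a + x) \<partial>lborel) = (\<integral>\<^sup>+x. f x \<partial>lborel)"
  by (subst (2) lborel_distr_plus[of a, symmetric]) (simp add: nn_integral_distr)

text \<open>
  A function is below the sum of the multiples \<open>c j\<close> of the indicators of balls of radius \<open>r j\<close> as soon as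
  each of its positive values is dominated by one of them. If \<open>c j\<close> times the volume of the ball is
  geometric in \<open>j\<close>, that sum is integrable.
\<close>

lemma nn_integral_finite_if_covered_by_balls:
  fixes f :: "'a::euclidean_space \<Rightarrow> real"
  assumes cover: "\<And>z. f z > 0 \<Longrightarrow> \<exists>j. norm z \<le> r j \<and> f z \<le> c j"
    and nonneg: "\<And>j. 0 \<le> r j" "\<And>j. 0 \<le> c j"
    and geom: "\<And>j. c j * r j ^ DIM('a) = C * q ^ j" and q: "0 \<le> q" "q < 1" and C: "0 \<le> C"
  shows "(\<integral>\<^sup>+z. ennreal (f z) \<partial>lborel) < \<infinity>"
proof -
  let ?V = "unit_ball_vol (real DIM('a))"
  have "ennreal (f z) \<le> (\<Sum>j. ennreal (c j) * indicator (cball 0 (r j)) z)" for z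
  proof (cases "f z > 0")
    case True
    then obtain j where j: "norm z \<le> r j" "f z \<le> c j" using cover by blast
    then have "ennreal (f z) \<le> ennreal (c j) * indicator (cball 0 (r j)) z"
      by (simp add: ennreal_leI)
    also have "\<dots> \<le> (\<Sum>j. ennreal (c j) * indicator (cball 0 (r j)) z)"
      using sum_le_suminf[of "\<lambda>j. ennreal (c j) * indicator (cball 0 (r j)) z" "{j}"]
      by (simp del: sum_mult_indicator)
    finally show ?thesis .
  qed (simp add: ennreal_neg)
  then have "(\<integral>\<^sup>+z. ennreal (f z) \<partial>lborel) \<le>
      (\<integral>\<^sup>+z. (\<Sum>j. ennreal (c j) * indicator (cball 0 (r j)) z) \<partial>(lborel :: 'a measure))"
    by (intro nn_integral_mono)
  also have "\<dots> = (\<Sum>j. \<integral>\<^sup>+z. ennreal (c j) * indicator (cball 0 (r j)) z \<partial>(lborel :: 'a measure))"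
    by (intro nn_integral_suminf borel_measurable_times_ennreal borel_measurable_const
        borel_measurable_indicator) simp
  also have "\<dots> = (\<Sum>j. ennreal (?V * (C * q ^ j)))"
  proof (intro arg_cong[of _ _ suminf] ext)
    fix j
    have "(\<integral>\<^sup>+z. ennreal (c j) * indicator (cball 0 (r j)) z \<partial>(lborel :: 'a measure)) =
        ennreal (c j) * ennreal (?V * r j ^ DIM('a))"
      by (subst nn_integral_cmult_indicator) (simp_all add: emeasure_cball nonneg)
    also have "\<dots> = ennreal (?V * (C * q ^ j))"
      unfolding geom[symmetric] using nonneg[of j] by (simp add: mult_ac flip: ennreal_mult')
    finally show "(\<integral>\<^sup>+z. ennreal (c j) * indicator (cball 0 (r j)) z \<partial>(lborel :: 'a measure)) =
        ennreal (?V * (C * q ^ j))" .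
  qed
  also have "\<dots> < \<infinity>"
    using q C by (subst suminf_ennreal2) (auto intro!: summable_mult summable_geometric)
  finally show ?thesis .
qed

text \<open>
  Near the origin the integrand is \<open>\<bar>z\<bar>\<close> to the power \<open>2 - n - 2s > - n\<close>, at infinity it is \<open>\<bar>z\<bar>\<close> to the
  power \<open>- n - 2s < - n\<close>. Splitting the space into dyadic shells, the contributions are geometric
  with ratio \<open>2\<^bsup>2s - 2\<^esup> < 1\<close> inside the unit ball and \<open>2\<^bsup>- 2s\<^esup> < 1\<close> outside.
\<close>

lemma Gagliardo_kernel_integrable:
  assumes s: "0 < s" "s < 1"
  shows "(\<integral>\<^sup>+z. ennreal (min ((norm z)\<^sup>2) 1 / norm z powr (real DIM('a) + 2 * s)) \<partial>(lborel :: 'a::euclidean_space measure)) < \<infinity>"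
proof -
  let ?n = "real DIM('a)" and ?b = "real DIM('a) + 2 * s"
  define k where "k z = min ((norm z)\<^sup>2) 1 / norm z powr ?b" for z :: 'a
  define f where "f z = (if norm z \<le> 1 then k z else 0)" for z
  define g where "g z = (if norm z \<le> 1 then 0 else k z)" for z
  have half: "(1 / 2 :: real) ^ j = 2 powr (- real j)" for j
    by (simp add: powr_minus powr_realpow power_one_over inverse_eq_divide)
  have pw: "x ^ DIM('a) = x powr ?n" if "x > 0" for x :: real
    using that by (simp add: powr_realpow)
  have "(\<integral>\<^sup>+z. ennreal (f z) \<partial>lborel) < \<infinity>"
  proof (rule nn_integral_finite_if_covered_by_balls)
    fix z assume "f z > 0"
    then have z: "norm z \<le> 1" "z \<noteq> 0" by (auto simp: f_def k_def split: if_splits)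
    define m where "m = (LEAST m. (1 / 2) ^ m < norm z)"
    have ex: "\<exists>m. (1 / 2) ^ m < norm z" using real_arch_pow_inv[of "norm z" "1/2"] z by auto
    have m: "(1 / 2) ^ m < norm z" unfolding m_def by (rule LeastI_ex[OF ex])
    then have "m \<noteq> 0" using z by (cases m) auto
    then obtain j where j: "m = Suc j" by (cases m) auto
    then have le: "norm z \<le> (1 / 2) ^ j"
      using not_less_Least[of j "\<lambda>m. (1 / 2) ^ m < norm z"] by (simp add: m_def)
    have "f z = (norm z)\<^sup>2 / norm z powr ?b"
      using z by (simp add: f_def k_def min_def power_le_one)
    also have "\<dots> \<le> ((1 / 2) ^ j)\<^sup>2 / ((1 / 2) ^ Suc j) powr ?b"
      using m le j s by (intro frac_le power_mono powr_mono2) (auto simp: less_imp_le)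
    also have "\<dots> = 2 powr ?b * 2 powr (real j * (?b - 2))"
    proof -
      have "((1 / 2) ^ j)\<^sup>2 = (2::real) powr (- 2 * real j)"
        unfolding half by (simp add: power2_eq_square flip: powr_add)
      moreover have "((1 / 2) ^ Suc j) powr ?b = 2 powr (- (real j + 1) * ?b)"
        unfolding half by (simp only: powr_powr of_nat_Suc add.commute)
      ultimately show ?thesis
        by (simp only: powr_diff[symmetric] powr_add[symmetric]) (simp add: algebra_simps)
    qed
    finally show "\<exists>j. norm z \<le> 2 powr (- real j) \<and> f z \<le> 2 powr ?b * 2 powr (real j * (?b - 2))"
      using le unfolding half by blast
  next
    show "2 powr ?b * 2 powr (real j * (?b - 2)) * (2 powr (- real j)) ^ DIM('a) = 2 powr ?b * (2 powr (2 * s - 2)) ^ j" for j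
      by (simp add: pw powr_powr powr_realpow[symmetric] powr_add[symmetric] algebra_simps)
    show "2 powr (2 * s - 2) < 1" using s by (simp add: powr_less_one)
  qed auto
  moreover have "(\<integral>\<^sup>+z. ennreal (g z) \<partial>lborel) < \<infinity>"
  proof (rule nn_integral_finite_if_covered_by_balls)
    fix z assume "g z > 0"
    then have z: "norm z > 1" by (auto simp: g_def split: if_splits)
    define m where "m = (LEAST m. norm z \<le> 2 ^ m)"
    have ex: "\<exists>m. norm z \<le> 2 ^ m" using real_arch_pow[of 2 "norm z"] by (auto intro: less_imp_le)
    have m: "norm z \<le> 2 ^ m" unfolding m_def by (rule LeastI_ex[OF ex])
    then have "m \<noteq> 0" using z by (cases m) auto
    then obtain j where j: "m = Suc j" by (cases m) auto
    then have ge: "norm z > 2 ^ j"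
      using not_less_Least[of j "\<lambda>m. norm z \<le> 2 ^ m"] by (simp add: m_def)
    have "g z = 1 / norm z powr ?b"
      using z min_absorb2[OF less_imp_le[OF one_less_power[OF z pos2]]]
      by (simp add: g_def k_def)
    also have "\<dots> \<le> 1 / (2 ^ j) powr ?b"
      using ge s by (intro frac_le powr_mono2) auto
    also have "\<dots> = 2 powr (- real j * ?b)"
      by (simp add: powr_realpow[symmetric] powr_powr powr_minus_divide)
    finally show "\<exists>j. norm z \<le> 2 powr (real j + 1) \<and> g z \<le> 2 powr (- real j * ?b)"
      using m j by (intro exI[of _ j]) (simp add: powr_add powr_realpow)
  next
    show "2 powr (- real j * ?b) * (2 powr (real j + 1)) ^ DIM('a) = 2 powr ?n * (2 powr (- 2 * s)) ^ j" for j
      by (simp add: pw powr_powr powr_realpow[symmetric] powr_add[symmetric] algebra_simps)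
    show "2 powr (- 2 * s) < 1" using s by (simp add: powr_less_one)
  qed auto
  moreover have "(\<integral>\<^sup>+z. ennreal (k z) \<partial>lborel) = (\<integral>\<^sup>+z. ennreal (f z) \<partial>lborel) + (\<integral>\<^sup>+z. ennreal (g z) \<partial>lborel)"
    by (subst nn_integral_add[symmetric]; (unfold f_def g_def k_def)?)
      (auto intro!: nn_integral_cong)
  ultimately show ?thesis unfolding k_def by simp
qed


definition gagliardo_energy :: "real \<Rightarrow> ('a::euclidean_space \<Rightarrow> real) \<Rightarrow> ennreal" where
  "gagliardo_energy s u =
     (\<integral>\<^sup>+ (x, y). ennreal (\<bar>u x - u y\<bar>\<^sup>2 / norm (x - y) powr (real DIM('a) + 2 * s))
        \<partial>(lborel :: ('a \<times> 'a) measure))"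

lemma gagliardo_seminorm_square: "(gagliardo_seminorm s u)\<^sup>2 = gagliardo_energy s u"
  by (simp add: gagliardo_seminorm_def gagliardo_energy_def enn_powr_half_square nn_integral_completion)

text \<open>
  For a short translation the Lipschitz bound gives a factor \<open>\<bar>z\<bar>\<^sup>2\<close> on a fixed ball; for a long one
  \<open>(a - b)\<^sup>2 \<le> 2 a\<^sup>2 + 2 b\<^sup>2\<close> and translation invariance give a constant.
\<close>

lemma translation_difference_energy_le:
  fixes \<phi> :: "'a::euclidean_space \<Rightarrow> real"
  assumes \<phi>: "\<phi> \<in> test_functions \<Omega>"
  obtains C where "C \<ge> 0"
    "\<And>z. (\<integral>\<^sup>+x. ennreal (\<bar>\<phi> x - \<phi> (x + z)\<bar>\<^sup>2) \<partial>lborel) \<le> ennreal (C * min ((norm z)\<^sup>2) 1)"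
proof -
  have m[measurable]: "\<phi> \<in> borel_measurable borel" by (rule test_borel_measurable[OF \<phi>])
  obtain L where L: "L > 0" "\<And>x y. \<bar>\<phi> x - \<phi> y\<bar> \<le> L * norm (x - y)"
    using test_Lipschitz[OF \<phi>] by blast
  obtain K where K: "compact K" "K \<subseteq> \<Omega>" "\<And>x. x \<notin> K \<Longrightarrow> \<phi> x = 0"
    using test_functionsE[OF \<phi>] by blast
  obtain R where R: "\<And>x. x \<in> K \<Longrightarrow> norm x \<le> R"
    using compact_imp_bounded[OF K(1)] unfolding bounded_iff by blast
  let ?B = "cball 0 (R + 1) :: 'a set"
  have fin: "emeasure lborel ?B < \<infinity>" by (rule emeasure_bounded_finite) simp
  have sq: "integrable lborel (\<lambda>x. (\<phi> x)\<^sup>2)"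
    using test_mult_integrable[OF \<phi> \<phi>] by (simp add: power2_eq_square)
  define I where "I = (LINT x|lborel. (\<phi> x)\<^sup>2)"
  define C where "C = L\<^sup>2 * measure lborel ?B + 4 * I"
  have I: "I \<ge> 0" by (simp add: I_def)
  have small: "(\<integral>\<^sup>+x. ennreal (\<bar>\<phi> x - \<phi> (x + z)\<bar>\<^sup>2) \<partial>lborel) \<le> ennreal (L\<^sup>2 * measure lborel ?B * (norm z)\<^sup>2)"
    if z: "norm z \<le> 1" for z
  proof -
    have "\<bar>\<phi> x - \<phi> (x + z)\<bar>\<^sup>2 \<le> (L * norm z)\<^sup>2 * indicator ?B x" for x
    proof (cases "x \<in> ?B")
      case True
      then show ?thesis
        using power_mono[OF L(2)[of x "x + z"], of 2] by simp
    next
      case False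
      then have "norm x > R + 1" by simp
      moreover have "norm (x + z) \<ge> norm x - norm z" using norm_triangle_ineq2[of x "- z"] by simp
      ultimately have "norm x > R" "norm (x + z) > R" using z by auto
      then have "\<phi> x = 0" "\<phi> (x + z) = 0" using K(3) R[of x] R[of "x + z"] by fastforce+
      then show ?thesis by simp
    qed
    then have "ennreal (\<bar>\<phi> x - \<phi> (x + z)\<bar>\<^sup>2) \<le> ennreal ((L * norm z)\<^sup>2 * indicator ?B x)" for x
      by (rule ennreal_leI)
    then have "(\<integral>\<^sup>+x. ennreal (\<bar>\<phi> x - \<phi> (x + z)\<bar>\<^sup>2) \<partial>lborel) \<le>
        (\<integral>\<^sup>+x. ennreal ((L * norm z)\<^sup>2) * indicator ?B x \<partial>lborel)"
      by (intro nn_integral_mono) (simp add: ennreal_mult' ennreal_indicator)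
    also have "\<dots> = ennreal ((L * norm z)\<^sup>2) * emeasure lborel ?B"
      by (rule nn_integral_cmult_indicator) simp
    also have "emeasure lborel ?B = ennreal (measure lborel ?B)"
      using fin by (intro emeasure_eq_ennreal_measure) auto
    finally show ?thesis
      by (simp add: power_mult_distrib mult_ac flip: ennreal_mult')
  qed
  have large: "(\<integral>\<^sup>+x. ennreal (\<bar>\<phi> x - \<phi> (x + z)\<bar>\<^sup>2) \<partial>lborel) \<le> ennreal (4 * I)" for z
  proof -
    have "\<bar>\<phi> x - \<phi> (x + z)\<bar>\<^sup>2 \<le> 2 * (\<phi> x)\<^sup>2 + 2 * (\<phi> (z + x))\<^sup>2" for x
      using zero_le_power2[of "\<phi> x + \<phi> (x + z)"]
      by (simp add: power2_eq_square algebra_simps)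
    then have "(\<integral>\<^sup>+x. ennreal (\<bar>\<phi> x - \<phi> (x + z)\<bar>\<^sup>2) \<partial>lborel) \<le>
        (\<integral>\<^sup>+x. ennreal (2 * (\<phi> x)\<^sup>2 + 2 * (\<phi> (z + x))\<^sup>2) \<partial>lborel)"
      by (intro nn_integral_mono ennreal_leI)
    also have "\<dots> = ennreal (LINT x|lborel. 2 * (\<phi> x)\<^sup>2 + 2 * (\<phi> (z + x))\<^sup>2)"
      using sq integrable_lborel_translate[OF sq, of z] by (intro nn_integral_eq_integral) auto
    also have "(LINT x|lborel. 2 * (\<phi> x)\<^sup>2 + 2 * (\<phi> (z + x))\<^sup>2) = 4 * I"
      using sq integrable_lborel_translate[OF sq, of z] integral_lborel_translate[of "\<lambda>x. (\<phi> x)\<^sup>2" z]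
      by (simp add: I_def)
    finally show ?thesis .
  qed
  show thesis
  proof (rule that[of C])
    show "C \<ge> 0" by (simp add: C_def I)
    show "(\<integral>\<^sup>+x. ennreal (\<bar>\<phi> x - \<phi> (x + z)\<bar>\<^sup>2) \<partial>lborel) \<le> ennreal (C * min ((norm z)\<^sup>2) 1)" for z
    proof (cases "norm z \<le> 1")
      case True
      then have "min ((norm z)\<^sup>2) 1 = (norm z)\<^sup>2" by (simp add: power_le_one)
      then show ?thesis
        by (intro order.trans[OF small[OF True]] ennreal_leI) (simp add: C_def I distrib_right)
    next
      case False
      then have "(norm z)\<^sup>2 \<ge> 1" by (simp add: one_le_power)
      then have "min ((norm z)\<^sup>2) 1 = 1" by simp
      then show ?thesis
        by (intro order.trans[OF large] ennreal_leI) (simp add: C_def)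
    qed
  qed
qed

text \<open>
  After the substitution \<open>y = x + z\<close> and an exchange of the integrals, the inner integral is the
  energy of a translation difference, and the integrable kernel above remains.
\<close>

lemma gagliardo_energy_test_finite:
  fixes \<phi> :: "'a::euclidean_space \<Rightarrow> real"
  assumes \<phi>: "\<phi> \<in> test_functions \<Omega>" and s: "0 < s" "s < 1"
  shows "gagliardo_energy s \<phi> < \<infinity>"
proof -
  let ?b = "real DIM('a) + 2 * s"
  have m[measurable]: "\<phi> \<in> borel_measurable borel" by (rule test_borel_measurable[OF \<phi>])
  obtain C where C: "C \<ge> 0"
    "\<And>z. (\<integral>\<^sup>+x. ennreal (\<bar>\<phi> x - \<phi> (x + z)\<bar>\<^sup>2) \<partial>lborel) \<le> ennreal (C * min ((norm z)\<^sup>2) 1)"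
    using translation_difference_energy_le[OF \<phi>] by blast
  define k where "k x y = ennreal (\<bar>\<phi> x - \<phi> y\<bar>\<^sup>2 / norm (x - y) powr ?b)" for x y
  have km: "(\<lambda>(x, y). k x y) \<in> borel_measurable (lborel \<Otimes>\<^sub>M lborel)"
    unfolding k_def by measurable
  have km': "(\<lambda>(x, z). k x (x + z)) \<in> borel_measurable (lborel \<Otimes>\<^sub>M lborel)"
    unfolding k_def by measurable
  have "gagliardo_energy s \<phi> = (\<integral>\<^sup>+p. (case p of (x, y) \<Rightarrow> k x y) \<partial>(lborel \<Otimes>\<^sub>M lborel))"
    unfolding gagliardo_energy_def lborel_prod k_def ..
  also have "\<dots> = (\<integral>\<^sup>+x. \<integral>\<^sup>+y. k x y \<partial>lborel \<partial>lborel)"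
    using lborel.nn_integral_fst[OF km] by simp
  also have "\<dots> = (\<integral>\<^sup>+x. \<integral>\<^sup>+z. k x (x + z) \<partial>lborel \<partial>lborel)"
  proof (rule nn_integral_cong)
    fix x
    have "k x \<in> borel_measurable borel" unfolding k_def by measurable
    then show "(\<integral>\<^sup>+y. k x y \<partial>lborel) = (\<integral>\<^sup>+z. k x (x + z) \<partial>lborel)"
      by (rule nn_integral_lborel_translate[symmetric])
  qed
  also have "\<dots> = (\<integral>\<^sup>+z. \<integral>\<^sup>+x. k x (x + z) \<partial>lborel \<partial>lborel)"
    using lborel_pair.Fubini[OF km'] by simp
  also have "\<dots> \<le> (\<integral>\<^sup>+z. ennreal C * ennreal (min ((norm z)\<^sup>2) 1 / norm z powr ?b) \<partial>(lborel :: 'a measure))"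
  proof (rule nn_integral_mono)
    fix z :: 'a
    have "(\<integral>\<^sup>+x. k x (x + z) \<partial>lborel) = (\<integral>\<^sup>+x. ennreal (1 / norm z powr ?b) * ennreal (\<bar>\<phi> x - \<phi> (x + z)\<bar>\<^sup>2) \<partial>lborel)"
      unfolding k_def by (intro nn_integral_cong) (simp flip: ennreal_mult')
    also have "\<dots> = ennreal (1 / norm z powr ?b) * (\<integral>\<^sup>+x. ennreal (\<bar>\<phi> x - \<phi> (x + z)\<bar>\<^sup>2) \<partial>lborel)"
      by (rule nn_integral_cmult) measurable
    also have "\<dots> \<le> ennreal (1 / norm z powr ?b) * ennreal (C * min ((norm z)\<^sup>2) 1)"
      by (intro mult_left_mono C) simp
    also have "\<dots> = ennreal C * ennreal (min ((norm z)\<^sup>2) 1 / norm z powr ?b)"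
      using C(1) by (simp flip: ennreal_mult')
    finally show "(\<integral>\<^sup>+x. k x (x + z) \<partial>lborel) \<le> ennreal C * ennreal (min ((norm z)\<^sup>2) 1 / norm z powr ?b)" .
  qed
  also have "\<dots> = ennreal C * (\<integral>\<^sup>+z. ennreal (min ((norm z)\<^sup>2) 1 / norm z powr ?b) \<partial>(lborel :: 'a measure))"
    by (rule nn_integral_cmult) measurable
  also have "\<dots> < \<infinity>"
    using Gagliardo_kernel_integrable[OF s, where 'a = 'a] by (simp add: ennreal_mult_less_top)
  finally show ?thesis .
qed

section \<open>Concentration by scaling\<close>

definition dirichlet_energy :: "('a::euclidean_space \<Rightarrow> real) \<Rightarrow> ennreal" where
  "dirichlet_energy \<phi> = (\<integral>\<^sup>+x. ennreal ((norm (gradient \<phi> x))\<^sup>2) \<partial>lborel)"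

lemma rho_square_test:
  "\<phi> \<in> test_functions \<Omega> \<Longrightarrow> (rho s \<phi>)\<^sup>2 = dirichlet_energy \<phi> + gagliardo_energy s \<phi>"
  by (simp add: rho_def enn_powr_half_square gradient_norm_test gagliardo_seminorm_square
      dirichlet_energy_def)

text \<open>
  The scaling factor is written as a real power so that it combines with the fractional powers of \<open>c\<close>
  coming from the Gagliardo kernel.
\<close>

lemma nn_integral_lborel_affine:
  fixes f :: "'a::euclidean_space \<Rightarrow> ennreal"
  assumes [measurable]: "f \<in> borel_measurable borel" and c: "c > 0"
  shows "(\<integral>\<^sup>+x. f (t + c *\<^sub>R x) \<partial>lborel) = ennreal (c powr - real DIM('a)) * (\<integral>\<^sup>+x. f x \<partial>lborel)"
proof -
  have "(\<integral>\<^sup>+x. f x \<partial>lborel) = ennreal (c ^ DIM('a)) * (\<integral>\<^sup>+x. f (t + c *\<^sub>R x) \<partial>lborel)"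
    using c by (subst lborel_affine[of c t])
      (simp_all add: nn_integral_density nn_integral_distr nn_integral_cmult ennreal_power)
  then have "ennreal (c powr - real DIM('a)) * (\<integral>\<^sup>+x. f x \<partial>lborel) =
      ennreal (c powr - real DIM('a) * c ^ DIM('a)) * (\<integral>\<^sup>+x. f (t + c *\<^sub>R x) \<partial>lborel)"
    by (simp add: ennreal_mult' mult.assoc)
  moreover have "c powr - real DIM('a) * c ^ DIM('a) = 1"
    using c by (simp add: powr_minus powr_realpow)
  ultimately show ?thesis by simp
qed

text \<open>
  How the three integrals of the problem react to rescaling. With \<open>a = c\<^bsup>(n - 2) / 2\<^esup>\<close> and \<open>p\<close> the critical
  exponent of dimension \<open>n\<close>, the factors of the Dirichlet energy and of the power integral become \<open>1\<close>,
  while that of the Gagliardo energy becomes \<open>c\<^bsup>2s - 2\<^esup>\<close>.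
\<close>

context
  fixes \<phi> :: "'a::euclidean_space \<Rightarrow> real" and \<Omega> :: "'a set" and a c :: real and t :: 'a
  assumes \<phi>: "\<phi> \<in> test_functions \<Omega>" and c: "c > 0"
begin

lemma gradient_affine: "gradient (\<lambda>x. a * \<phi> (t + c *\<^sub>R x)) x = (a * c) *\<^sub>R gradient \<phi> (t + c *\<^sub>R x)"
proof -
  have "((\<lambda>x. a * \<phi> (t + c *\<^sub>R x)) has_derivative
      (\<lambda>h. a * (c * frechet_derivative \<phi> (at (t + c *\<^sub>R x)) h))) (at x)"
    by (intro has_derivative_mult_right has_derivative_affine test_has_derivative[OF \<phi>])
  from frechet_derivative_at[OF this, symmetric]
  show ?thesis by (simp add: gradient_def scaleR_sum_right mult.assoc)
qed

lemma dirichlet_energy_affine: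
  "dirichlet_energy (\<lambda>x. a * \<phi> (t + c *\<^sub>R x)) =
    ennreal (a\<^sup>2 * c powr (2 - real DIM('a))) * dirichlet_energy \<phi>"
proof -
  have m[measurable]: "gradient \<phi> \<in> borel_measurable borel"
    by (intro borel_measurable_continuous_onI gradient_continuous[OF \<phi>])
  have "dirichlet_energy (\<lambda>x. a * \<phi> (t + c *\<^sub>R x)) =
      (\<integral>\<^sup>+x. ennreal ((a * c)\<^sup>2) * ennreal ((norm (gradient \<phi> (t + c *\<^sub>R x)))\<^sup>2) \<partial>lborel)"
    unfolding dirichlet_energy_def gradient_affine
    by (simp add: power_mult_distrib flip: ennreal_mult')
  also have "\<dots> = ennreal ((a * c)\<^sup>2) * (\<integral>\<^sup>+x. ennreal ((norm (gradient \<phi> (t + c *\<^sub>R x)))\<^sup>2) \<partial>lborel)"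
    by (rule nn_integral_cmult) measurable
  also have "(\<integral>\<^sup>+x. ennreal ((norm (gradient \<phi> (t + c *\<^sub>R x)))\<^sup>2) \<partial>lborel) =
      ennreal (c powr - real DIM('a)) * dirichlet_energy \<phi>"
    unfolding dirichlet_energy_def
    by (rule nn_integral_lborel_affine[of "\<lambda>x. ennreal ((norm (gradient \<phi> x))\<^sup>2)", OF _ c]) measurable
  also have "ennreal ((a * c)\<^sup>2) * (ennreal (c powr - real DIM('a)) * dirichlet_energy \<phi>) =
      ennreal (a\<^sup>2 * c powr (2 - real DIM('a))) * dirichlet_energy \<phi>"
    using c by (simp add: power_mult_distrib powr_diff powr_minus_divide mult.assoc[symmetric] flip: ennreal_mult')
  finally show ?thesis .
qed

lemma gagliardo_energy_affine:
  "gagliardo_energy s (\<lambda>x. a * \<phi> (t + c *\<^sub>R x)) =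
    ennreal (a\<^sup>2 * c powr (2 * s - real DIM('a))) * gagliardo_energy s \<phi>"
proof -
  let ?b = "real DIM('a) + 2 * s"
  have m[measurable]: "\<phi> \<in> borel_measurable borel" by (rule test_borel_measurable[OF \<phi>])
  define k where "k p = (case p of (x, y) \<Rightarrow> ennreal (\<bar>\<phi> x - \<phi> y\<bar>\<^sup>2 / norm (x - y) powr ?b))" for p
  have km[measurable]: "k \<in> borel_measurable borel"
    unfolding k_def borel_prod[symmetric] by measurable
  have "ennreal (\<bar>a * \<phi> (t + c *\<^sub>R x) - a * \<phi> (t + c *\<^sub>R y)\<bar>\<^sup>2 / norm (x - y) powr ?b) =
      ennreal (a\<^sup>2 * c powr ?b) * k ((t, t) + c *\<^sub>R (x, y))" for x y
  proof -
    have "(t + c *\<^sub>R x) - (t + c *\<^sub>R y) = c *\<^sub>R (x - y)" by (simp add: algebra_simps)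
    then have "norm ((t + c *\<^sub>R x) - (t + c *\<^sub>R y)) powr ?b = c powr ?b * norm (x - y) powr ?b"
      using c by (simp add: powr_mult)
    moreover have "\<bar>a * \<phi> (t + c *\<^sub>R x) - a * \<phi> (t + c *\<^sub>R y)\<bar>\<^sup>2 =
        a\<^sup>2 * \<bar>\<phi> (t + c *\<^sub>R x) - \<phi> (t + c *\<^sub>R y)\<bar>\<^sup>2"
      by (simp add: power_mult_distrib right_diff_distrib[symmetric])
    ultimately show ?thesis
      using c by (simp add: k_def flip: ennreal_mult')
  qed
  then have "gagliardo_energy s (\<lambda>x. a * \<phi> (t + c *\<^sub>R x)) =
      (\<integral>\<^sup>+p. ennreal (a\<^sup>2 * c powr ?b) * k ((t, t) + c *\<^sub>R p) \<partial>lborel)"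
    unfolding gagliardo_energy_def by (intro nn_integral_cong) (simp only: split_paired_all prod.case)
  also have "\<dots> = ennreal (a\<^sup>2 * c powr ?b) * (\<integral>\<^sup>+p. k ((t, t) + c *\<^sub>R p) \<partial>lborel)"
    by (rule nn_integral_cmult) measurable
  also have "(\<integral>\<^sup>+p. k ((t, t) + c *\<^sub>R p) \<partial>lborel) = ennreal (c powr - real DIM('a \<times> 'a)) * (\<integral>\<^sup>+p. k p \<partial>lborel)"
    by (rule nn_integral_lborel_affine[OF km c])
  also have "(\<integral>\<^sup>+p. k p \<partial>lborel) = gagliardo_energy s \<phi>"
    unfolding gagliardo_energy_def k_def ..
  also have "ennreal (a\<^sup>2 * c powr ?b) * (ennreal (c powr - real DIM('a \<times> 'a)) * gagliardo_energy s \<phi>) =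
      ennreal (a\<^sup>2 * c powr (2 * s - real DIM('a))) * gagliardo_energy s \<phi>"
  proof -
    have "c powr ?b * c powr - real DIM('a \<times> 'a) = c powr (2 * s - real DIM('a))"
      by (simp flip: powr_add)
    then have "a\<^sup>2 * c powr ?b * c powr - real DIM('a \<times> 'a) = a\<^sup>2 * c powr (2 * s - real DIM('a))"
      by (simp only: mult.assoc)
    moreover have "ennreal (a\<^sup>2 * c powr ?b) * ennreal (c powr - real DIM('a \<times> 'a)) =
        ennreal (a\<^sup>2 * c powr ?b * c powr - real DIM('a \<times> 'a))"
      by (rule ennreal_mult[symmetric]) simp_all
    ultimately show ?thesis by (simp only: mult.assoc[symmetric])
  qed
  finally show ?thesis .
qed

lemma power_integral_affine:
  "(\<integral>\<^sup>+x. ennreal (\<bar>a * \<phi> (t + c *\<^sub>R x)\<bar> powr p) \<partial>lborel) =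
    ennreal (\<bar>a\<bar> powr p * c powr - real DIM('a)) * (\<integral>\<^sup>+x. ennreal (\<bar>\<phi> x\<bar> powr p) \<partial>lborel)"
proof -
  have m[measurable]: "\<phi> \<in> borel_measurable borel" by (rule test_borel_measurable[OF \<phi>])
  have "(\<integral>\<^sup>+x. ennreal (\<bar>a * \<phi> (t + c *\<^sub>R x)\<bar> powr p) \<partial>lborel) =
      (\<integral>\<^sup>+x. ennreal (\<bar>a\<bar> powr p) * ennreal (\<bar>\<phi> (t + c *\<^sub>R x)\<bar> powr p) \<partial>lborel)"
    by (simp add: abs_mult powr_mult flip: ennreal_mult')
  also have "\<dots> = ennreal (\<bar>a\<bar> powr p) * (\<integral>\<^sup>+x. ennreal (\<bar>\<phi> (t + c *\<^sub>R x)\<bar> powr p) \<partial>lborel)"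
    by (rule nn_integral_cmult) measurable
  also have "(\<integral>\<^sup>+x. ennreal (\<bar>\<phi> (t + c *\<^sub>R x)\<bar> powr p) \<partial>lborel) =
      ennreal (c powr - real DIM('a)) * (\<integral>\<^sup>+x. ennreal (\<bar>\<phi> x\<bar> powr p) \<partial>lborel)"
    by (rule nn_integral_lborel_affine[of "\<lambda>x. ennreal (\<bar>\<phi> x\<bar> powr p)", OF _ c]) measurable
  finally show ?thesis by (simp add: ennreal_mult' mult.assoc)
qed

end

text \<open>
  The substitution shrinks the support towards \<open>x0\<close>, so a test function on the whole space becomes
  one on \<open>\<Omega>\<close> if \<open>c\<close> is large.
\<close>

lemma test_affine:
  fixes \<phi> :: "'a::euclidean_space \<Rightarrow> real"
  assumes \<phi>: "\<phi> \<in> test_functions UNIV" and c: "c > 0" and R: "\<And>x. \<phi> x \<noteq> 0 \<Longrightarrow> norm x \<le> R"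
    and sub: "cball x0 (R / c) \<subseteq> \<Omega>"
  shows "(\<lambda>x. a * \<phi> (- (c *\<^sub>R x0) + c *\<^sub>R x)) \<in> test_functions \<Omega>"
proof (rule test_functionsI[OF _ compact_cball sub])
  show "C_diff k (\<lambda>x. a * \<phi> (- (c *\<^sub>R x0) + c *\<^sub>R x))" for k
    by (intro C_diff_cmult C_diff_affine test_C_diff[OF \<phi>])
  show "a * \<phi> (- (c *\<^sub>R x0) + c *\<^sub>R x) = 0" if "x \<notin> cball x0 (R / c)" for x
  proof -
    have "- (c *\<^sub>R x0) + c *\<^sub>R x = c *\<^sub>R (x - x0)" by (simp add: algebra_simps)
    then have "norm (- (c *\<^sub>R x0) + c *\<^sub>R x) = c * dist x0 x"
      using c by (simp add: dist_norm norm_minus_commute)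
    also have "\<dots> > R" using that c by (simp add: field_simps)
    finally show ?thesis using R[of "- (c *\<^sub>R x0) + c *\<^sub>R x"] by force
  qed
qed

text \<open>
  Shrink the support of \<open>\<phi>\<close> into a small ball inside \<open>\<Omega>\<close> and normalise the
  result in the critical Lebesgue space. The critical exponent is the one for which the Dirichlet
  energy of the outcome does not depend on \<open>c\<close>, whereas its Gagliardo energy carries the factor
  \<open>c\<^bsup>2s - 2\<^esup>\<close>. As \<open>c\<close> tends to infinity the nonlocal part disappears, so the mixed constant is bounded
  by the purely local quotient of an arbitrary test function on the whole space.
\<close>

lemma sobolev_const_le_dirichlet_quotient:
  fixes \<phi> :: "'a::euclidean_space \<Rightarrow> real" and \<Omega> :: "'a set"
  assumes dim: "DIM('a) \<ge> 3" and s: "0 < s" "s < 1" and \<Omega>: "open \<Omega>" "\<Omega> \<noteq> {}"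
    and \<phi>: "\<phi> \<in> test_functions UNIV"
    and A: "(\<integral>\<^sup>+x. ennreal (\<bar>\<phi> x\<bar> powr crit_exp DIM('a)) \<partial>lborel) = ennreal A" "A > 0"
    and E: "dirichlet_energy \<phi> = ennreal E" "E \<ge> 0"
  shows "sobolev_const s \<Omega> \<le> ennreal (A powr (- 2 / crit_exp DIM('a)) * E)"
proof -
  define p where "p = crit_exp DIM('a)"
  let ?n = "real DIM('a)"
  have p: "p > 0" "2 * ?n / p = ?n - 2" using dim by (auto simp: p_def crit_exp_def)
  obtain x0 where x0: "x0 \<in> \<Omega>" using \<Omega> by blast
  obtain r where r: "r > 0" "cball x0 r \<subseteq> \<Omega>" using \<Omega>(1) x0 open_contains_cball by blast
  obtain K where K: "compact K" "K \<subseteq> UNIV" "\<And>x. x \<notin> K \<Longrightarrow> \<phi> x = 0"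
    using test_functionsE[OF \<phi>] by blast
  obtain R where R: "\<And>x. x \<in> K \<Longrightarrow> norm x \<le> R"
    using compact_imp_bounded[OF K(1)] unfolding bounded_iff by blast
  obtain G where G: "gagliardo_energy s \<phi> = ennreal G" "G \<ge> 0"
    using gagliardo_energy_test_finite[OF \<phi> s] by (auto simp: less_top_ennreal)
  have bound: "sobolev_const s \<Omega> \<le> ennreal (A powr (- 2 / p) * (E + c powr (2 * s - 2) * G))"
    if c: "c > 0" "R / c \<le> r" for c
  proof -
    \<comment> \<open>The amplitude that makes the rescaled function have critical norm \<open>1\<close>.\<close>
    define a where "a = A powr (- 1 / p) * c powr (?n / p)"
    define \<psi> where "\<psi> = (\<lambda>x. a * \<phi> (- (c *\<^sub>R x0) + c *\<^sub>R x))"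
    have a2: "a\<^sup>2 = A powr (- 2 / p) * c powr (?n - 2)"
      unfolding a_def power_mult_distrib p(2)[symmetric]
      by (simp add: power2_eq_square flip: powr_add)
    have "\<bar>a\<bar> powr p = A powr - 1 * c powr ?n"
      using p by (simp add: a_def powr_mult powr_powr)
    then have ap: "\<bar>a\<bar> powr p * c powr - ?n * A = 1"
      using A(2) c by (simp add: powr_minus field_simps)
    have \<psi>: "\<psi> \<in> test_functions \<Omega>"
      unfolding \<psi>_def
    proof (rule test_affine[OF \<phi> c(1)])
      show "norm x \<le> R" if "\<phi> x \<noteq> 0" for x using that R K(3) by blast
      show "cball x0 (R / c) \<subseteq> \<Omega>" using r(2) c(2) by (meson cball_subset_cball_iff order.trans subset_cball)
    qed
    have "(\<integral>\<^sup>+x. ennreal (\<bar>\<psi> x\<bar> powr p) \<partial>lborel) = 1"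
      unfolding \<psi>_def power_integral_affine[OF \<phi> c(1)] A(1)[folded p_def]
      using ap by (simp flip: ennreal_mult')
    then have "Lp_norm p \<psi> = 1"
      by (simp add: Lp_norm_def enn_powr_def nn_integral_completion)
    then have "sobolev_const s \<Omega> \<le> (rho s \<psi>)\<^sup>2"
      unfolding sobolev_const_def p_def using \<psi> by (intro Inf_lower) blast
    also have "\<dots> = ennreal (a\<^sup>2 * c powr (2 - ?n) * E) + ennreal (a\<^sup>2 * c powr (2 * s - ?n) * G)"
      unfolding rho_square_test[OF \<psi>] unfolding \<psi>_def
        dirichlet_energy_affine[OF \<phi> c(1)] gagliardo_energy_affine[OF \<phi> c(1)] E G
      by (simp add: ennreal_mult' E(2) G(2))
    also have "\<dots> = ennreal (a\<^sup>2 * c powr (2 - ?n) * E + a\<^sup>2 * c powr (2 * s - ?n) * G)"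
      by (rule ennreal_plus[symmetric]) (simp_all add: E(2) G(2))
    also have "a\<^sup>2 * c powr (2 - ?n) = A powr (- 2 / p)"
      unfolding a2 mult.assoc powr_add[symmetric] using c by simp
    also have "a\<^sup>2 * c powr (2 * s - ?n) = A powr (- 2 / p) * c powr (2 * s - 2)"
      unfolding a2 mult.assoc powr_add[symmetric] by simp
    finally show ?thesis by (simp add: algebra_simps)
  qed
  have "((\<lambda>c. c powr (2 * s - 2)) \<longlongrightarrow> 0) at_top"
    using s by (intro tendsto_neg_powr filterlim_ident) simp
  then have "((\<lambda>c. ennreal (A powr (- 2 / p) * (E + c powr (2 * s - 2) * G))) \<longlongrightarrow>
      ennreal (A powr (- 2 / p) * (E + 0 * G))) at_top"
    by (intro tendsto_intros)
  then have "sobolev_const s \<Omega> \<le> ennreal (A powr (- 2 / p) * (E + 0 * G))"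
  proof (rule tendsto_lowerbound)
    show "\<forall>\<^sub>F c in at_top. sobolev_const s \<Omega> \<le> ennreal (A powr (- 2 / p) * (E + c powr (2 * s - 2) * G))"
      using eventually_gt_at_top[of 0] eventually_ge_at_top[of "R / r"]
    proof eventually_elim
      case (elim c)
      then show ?case using r(1) by (intro bound) (auto simp: field_simps)
    qed
  qed simp
  then show ?thesis by (simp add: p_def)
qed

section \<open>Passing to the limit along an approximating sequence\<close>

lemma nn_integral_le_if_Lp_norm_less:
  assumes "Lp_norm p f < ennreal \<epsilon>" "p > 0"
  shows "(\<integral>\<^sup>+x. ennreal (norm (f x) powr p) \<partial>lebesgue) \<le> ennreal (\<epsilon> powr p)"
proof -
  let ?I = "\<integral>\<^sup>+x. ennreal (norm (f x) powr p) \<partial>lebesgue"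
  have fin: "?I \<noteq> \<infinity>" using assms by (auto simp: Lp_norm_def enn_powr_def)
  then obtain r where r: "?I = ennreal r" "r \<ge> 0" by (cases ?I) auto
  then have "r powr (1 / p) < \<epsilon>"
    using assms(1) fin by (simp add: Lp_norm_def enn_powr_def ennreal_less_iff)
  then have "(r powr (1 / p)) powr p \<le> \<epsilon> powr p"
    using assms(2) by (intro powr_mono2) auto
  then show ?thesis using r assms(2) by (simp add: powr_powr ennreal_leI)
qed

text \<open>
  On the support of \<open>h\<close> one has \<open>\<bar>v\<bar> \<le> \<epsilon> + \<epsilon>\<^bsup>1 - p\<^esup> \<bar>v\<bar>\<^sup>p\<close>: either \<open>\<bar>v\<bar> \<le> \<epsilon>\<close> or \<open>(\<bar>v\<bar> / \<epsilon>)\<^bsup>p - 1\<^esup> \<ge> 1\<close>. Integrated,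
  the first term contributes a multiple of \<open>\<epsilon>\<close> and the second tends to \<open>0\<close>.
\<close>

lemma pairing_tendsto_0:
  fixes v :: "nat \<Rightarrow> 'a::euclidean_space \<Rightarrow> real"
  assumes v: "\<And>k. v k \<in> borel_measurable lebesgue" and lim: "(\<lambda>k. Lp_norm p (v k)) \<longlonglongrightarrow> 0"
    and p: "p \<ge> 1" and h: "h \<in> test_functions \<Omega>"
  shows "(\<lambda>k. LINT x|lebesgue. v k x * h x) \<longlonglongrightarrow> 0"
proof -
  obtain K where K: "compact K" "K \<subseteq> \<Omega>" "\<And>x. x \<notin> K \<Longrightarrow> h x = 0"
    using test_functionsE[OF h] by blast
  obtain M where M: "M > 0" "\<And>x. \<bar>h x\<bar> \<le> M" using test_bounded[OF h] by blast
  have Kb: "K \<in> sets lebesgue" using K(1) by (simp add: lmeasurable_compact fmeasurableD)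
  have "emeasure lebesgue K < \<infinity>"
    using emeasure_bounded_finite[OF compact_imp_bounded[OF K(1)]] K(1)
    by (simp add: compact_imp_closed)
  then obtain V where V: "emeasure lebesgue K = ennreal V" "V \<ge> 0" by (auto simp: less_top_ennreal)
  have bound: "\<bar>LINT x|lebesgue. v k x * h x\<bar> \<le> M * \<epsilon> * (V + 1)"
    if \<epsilon>: "\<epsilon> > 0" and less: "Lp_norm p (v k) < ennreal \<epsilon>" for k \<epsilon>
  proof -
    have pt: "ennreal (norm (v k x * h x)) \<le>
        ennreal (M * \<epsilon>) * indicator K x + ennreal (M * \<epsilon> powr (1 - p)) * ennreal (norm (v k x) powr p)" for x
    proof (cases "x \<in> K")
      case True
      have "\<bar>v k x\<bar> \<le> \<epsilon> + \<epsilon> powr (1 - p) * \<bar>v k x\<bar> powr p"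
      proof (cases "\<bar>v k x\<bar> \<le> \<epsilon>")
        case False
        then have "1 \<le> (\<bar>v k x\<bar> / \<epsilon>) powr (p - 1)"
          using \<epsilon> p by (intro ge_one_powr_ge_zero) (auto simp: field_simps)
        then have "\<bar>v k x\<bar> * 1 \<le> \<bar>v k x\<bar> * (\<bar>v k x\<bar> / \<epsilon>) powr (p - 1)"
          by (intro mult_left_mono) auto
        also have "\<dots> = \<epsilon> powr (1 - p) * \<bar>v k x\<bar> powr p"
          using False \<epsilon> by (simp add: powr_divide powr_diff field_simps)
        finally show ?thesis using \<epsilon> by simp
      qed (simp add: add_increasing2)
      then have "\<bar>v k x\<bar> * \<bar>h x\<bar> \<le> (\<epsilon> + \<epsilon> powr (1 - p) * \<bar>v k x\<bar> powr p) * M"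
        using M by (intro mult_mono) auto
      then have "ennreal (norm (v k x * h x)) \<le> ennreal (M * \<epsilon> + M * \<epsilon> powr (1 - p) * norm (v k x) powr p)"
        by (intro ennreal_leI) (simp add: abs_mult algebra_simps)
      also have "\<dots> = ennreal (M * \<epsilon>) * indicator K x + ennreal (M * \<epsilon> powr (1 - p)) * ennreal (norm (v k x) powr p)"
        using True M \<epsilon> by (simp add: ennreal_plus ennreal_mult' mult_nonneg_nonneg)
      finally show ?thesis .
    qed (simp add: K(3))
    have vm: "(\<lambda>x. ennreal (norm (v k x) powr p)) \<in> borel_measurable lebesgue" using v[of k] by measurable
    have "ennreal \<bar>LINT x|lebesgue. v k x * h x\<bar> \<le> (\<integral>\<^sup>+x. ennreal (norm (v k x * h x)) \<partial>lebesgue)"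
      using integral_norm_bound_ennreal[of lebesgue "\<lambda>x. v k x * h x"]
      by (cases "integrable lebesgue (\<lambda>x. v k x * h x)") (auto simp: not_integrable_integral_eq)
    also have "\<dots> \<le> (\<integral>\<^sup>+x. ennreal (M * \<epsilon>) * indicator K x + ennreal (M * \<epsilon> powr (1 - p)) * ennreal (norm (v k x) powr p) \<partial>lebesgue)"
      by (intro nn_integral_mono pt)
    also have "\<dots> = ennreal (M * \<epsilon>) * ennreal V +
        ennreal (M * \<epsilon> powr (1 - p)) * (\<integral>\<^sup>+x. ennreal (norm (v k x) powr p) \<partial>lebesgue)"
      using vm Kb by (subst nn_integral_add) (simp_all add: nn_integral_cmult nn_integral_cmult_indicator V)
    also have "\<dots> \<le> ennreal (M * \<epsilon>) * ennreal V + ennreal (M * \<epsilon> powr (1 - p)) * ennreal (\<epsilon> powr p)"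
      using p by (intro add_left_mono mult_left_mono nn_integral_le_if_Lp_norm_less[OF less]) auto
    also have "\<dots> = ennreal (M * \<epsilon> * (V + 1))"
    proof -
      have "M * \<epsilon> * V + M * \<epsilon> powr (1 - p) * \<epsilon> powr p = M * \<epsilon> * (V + 1)"
        using \<epsilon> by (simp add: mult.assoc powr_add[symmetric] distrib_left)
      then show ?thesis
        using M \<epsilon> V(2) by (simp flip: ennreal_mult' ennreal_plus)
    qed
    finally show ?thesis using M \<epsilon> V(2) by (simp add: ennreal_le_iff)
  qed
  show ?thesis
  proof (rule LIMSEQ_I)
    fix r :: real assume r: "r > 0"
    define \<epsilon> where "\<epsilon> = r / (2 * M * (V + 1))"
    have \<epsilon>: "\<epsilon> > 0" using r M V by (simp add: \<epsilon>_def)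
    have "M * \<epsilon> * (V + 1) = r / 2" using M V by (simp add: \<epsilon>_def field_simps add_nonneg_eq_0_iff)
    then have eps: "M * \<epsilon> * (V + 1) < r" using r by simp
    have "\<forall>\<^sub>F k in sequentially. Lp_norm p (v k) < ennreal \<epsilon>"
      using lim \<epsilon> by (intro order_tendstoD) auto
    then obtain N where "\<And>k. k \<ge> N \<Longrightarrow> Lp_norm p (v k) < ennreal \<epsilon>"
      by (auto simp: eventually_sequentially)
    then show "\<exists>N. \<forall>k\<ge>N. norm ((LINT x|lebesgue. v k x * h x) - 0) < r"
      using bound[OF \<epsilon>] eps by (intro exI[of _ N]) fastforce
  qed
qed

lemma test_gradient_inner_integrable:
  fixes \<phi> \<psi> :: "'a::euclidean_space \<Rightarrow> real"
  assumes "\<phi> \<in> test_functions \<Omega>" "\<psi> \<in> test_functions \<Omega>'"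
  shows "integrable lborel (\<lambda>x. gradient \<phi> x \<bullet> gradient \<psi> x)"
proof -
  have "gradient \<phi> x \<bullet> gradient \<psi> x = (\<Sum>i\<in>Basis. partial_deriv i \<phi> x * partial_deriv i \<psi> x)" for x
    by (simp add: euclidean_inner[of "gradient \<phi> x" "gradient \<psi> x"] gradient_inner)
  then show ?thesis
    using assms by (simp add: test_mult_integrable[OF test_partial_deriv test_partial_deriv])
qed

lemma dirichlet_energy_eq_integral:
  fixes \<phi> :: "'a::euclidean_space \<Rightarrow> real"
  assumes "\<phi> \<in> test_functions \<Omega>"
  shows "dirichlet_energy \<phi> = ennreal (LINT x|lborel. gradient \<phi> x \<bullet> gradient \<phi> x)"
  unfolding dirichlet_energy_def power2_norm_eq_inner
  by (rule nn_integral_eq_integral[OF test_gradient_inner_integrable[OF assms assms]]) simp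

lemma gradient_diff:
  assumes "\<phi> \<in> test_functions \<Omega>" "\<psi> \<in> test_functions \<Omega>"
  shows "gradient (\<lambda>x. \<phi> x - \<psi> x) x = gradient \<phi> x - gradient \<psi> x"
  using frechet_derivative_at[OF has_derivative_diff[OF test_has_derivative[OF assms(1), of x]
        test_has_derivative[OF assms(2), of x]], symmetric]
  by (simp add: gradient_def scaleR_diff_left sum_subtractf)

text \<open>
  The components of \<open>gradient \<psi>\<close> are themselves test functions, so the definition of the weak gradient
  applies to them.
\<close>

lemma weak_gradient_pairing:
  fixes u :: "'a::euclidean_space \<Rightarrow> real"
  assumes g: "is_weak_gradient u g" and \<psi>: "\<psi> \<in> test_functions \<Omega>"
  shows "integrable lebesgue (\<lambda>x. g x \<bullet> gradient \<psi> x)"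
    and "(LINT x|lebesgue. g x \<bullet> gradient \<psi> x) =
      - (\<Sum>i\<in>Basis. LINT x|lebesgue. u x * partial_deriv i (partial_deriv i \<psi>) x)"
proof -
  note \<psi>' = test_partial_deriv[OF test_UNIV[OF \<psi>]]
  have int: "integrable lebesgue (\<lambda>x. (g x \<bullet> i) * partial_deriv i \<psi> x)" if "i \<in> Basis" for i
    using g by (intro locally_integrable_mult_test[OF _ \<psi>'[OF that]]
        weak_gradient_component_locally_integrable) (simp add: is_weak_gradient_def)
  have eq: "g x \<bullet> gradient \<psi> x = (\<Sum>i\<in>Basis. (g x \<bullet> i) * partial_deriv i \<psi> x)" for x
    by (simp add: euclidean_inner[of "g x" "gradient \<psi> x"] gradient_inner)
  show "integrable lebesgue (\<lambda>x. g x \<bullet> gradient \<psi> x)"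
    unfolding eq by (intro Bochner_Integration.integrable_sum int)
  have "(LINT x|lebesgue. g x \<bullet> gradient \<psi> x) = (\<Sum>i\<in>Basis. LINT x|lebesgue. (g x \<bullet> i) * partial_deriv i \<psi> x)"
    unfolding eq by (intro Bochner_Integration.integral_sum int)
  also have "\<dots> = (\<Sum>i\<in>Basis. - (LINT x|lebesgue. u x * partial_deriv i (partial_deriv i \<psi>) x))"
    using g \<psi>' by (intro sum.cong) (auto simp: is_weak_gradient_def)
  finally show "(LINT x|lebesgue. g x \<bullet> gradient \<psi> x) =
      - (\<Sum>i\<in>Basis. LINT x|lebesgue. u x * partial_deriv i (partial_deriv i \<psi>) x)"
    by (simp add: sum_negf)
qed

text \<open>
  The gradients are compared with \<open>g\<close> by duality, with the gradients themselves as test fields. Fix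
  \<open>m\<close> large. Polarisation gives \<open>\<bar>\<nabla>\<phi>\<^sub>k\<bar>\<^sup>2 + \<bar>\<nabla>\<phi>\<^sub>m\<bar>\<^sup>2 - 2 \<nabla>\<phi>\<^sub>k \<bullet> \<nabla>\<phi>\<^sub>m = \<bar>\<nabla>(\<phi>\<^sub>k - \<phi>\<^sub>m)\<bar>\<^sup>2\<close>, whose integral is small by the
  Cauchy property. Because \<open>\<nabla>\<phi>\<^sub>m\<close> is itself an admissible test field, the mixed term converges, as
  \<open>k\<close> grows, to the integral of \<open>g \<bullet> \<nabla>\<phi>\<^sub>m\<close>, and \<open>2 g \<bullet> \<nabla>\<phi>\<^sub>m \<le> \<bar>g\<bar>\<^sup>2 + \<bar>\<nabla>\<phi>\<^sub>m\<bar>\<^sup>2\<close>. The energies of \<open>\<phi>\<^sub>m\<close> cancel.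
\<close>

lemma dirichlet_energy_eventually_le:
  fixes u :: "'a::euclidean_space \<Rightarrow> real"
  assumes \<phi>: "\<And>k. \<phi> k \<in> test_functions \<Omega>" and g: "is_weak_gradient u g"
    and lim: "(\<lambda>k. Lp_norm p (\<lambda>x. \<phi> k x - u x)) \<longlonglongrightarrow> 0" and p: "p \<ge> 1"
    and Cauchy: "\<And>\<epsilon>. \<epsilon> > 0 \<Longrightarrow> \<exists>N. \<forall>k\<ge>N. \<forall>m\<ge>N. dirichlet_energy (\<lambda>x. \<phi> k x - \<phi> m x) \<le> ennreal \<epsilon>"
    and W: "(\<integral>\<^sup>+x. ennreal ((norm (g x))\<^sup>2) \<partial>lebesgue) = ennreal W" "W \<ge> 0" and \<epsilon>: "\<epsilon> > 0"
  shows "\<forall>\<^sub>F k in sequentially. dirichlet_energy (\<phi> k) \<le> ennreal (W + \<epsilon>)"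
proof -
  define E where "E k = (LINT x|lborel. gradient (\<phi> k) x \<bullet> gradient (\<phi> k) x)" for k
  define B where "B k m = (LINT x|lborel. gradient (\<phi> k) x \<bullet> gradient (\<phi> m) x)" for k m
  obtain m where m: "\<And>k. k \<ge> m \<Longrightarrow> dirichlet_energy (\<lambda>x. \<phi> k x - \<phi> m x) \<le> ennreal (\<epsilon> / 2)"
    using Cauchy[of "\<epsilon> / 2"] \<epsilon> by auto
  have polar: "E k + E m - 2 * B k m \<le> \<epsilon> / 2" if "k \<ge> m" for k
  proof -
    have "dirichlet_energy (\<lambda>x. \<phi> k x - \<phi> m x) =
        ennreal (LINT x|lborel. gradient (\<phi> k) x \<bullet> gradient (\<phi> k) x + gradient (\<phi> m) x \<bullet> gradient (\<phi> m) x
          - 2 * (gradient (\<phi> k) x \<bullet> gradient (\<phi> m) x))"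
      unfolding dirichlet_energy_eq_integral[OF test_diff[OF \<phi> \<phi>]] gradient_diff[OF \<phi> \<phi>]
      by (simp add: inner_diff_left inner_diff_right inner_commute algebra_simps)
    also have "(LINT x|lborel. gradient (\<phi> k) x \<bullet> gradient (\<phi> k) x + gradient (\<phi> m) x \<bullet> gradient (\<phi> m) x
          - 2 * (gradient (\<phi> k) x \<bullet> gradient (\<phi> m) x)) = E k + E m - 2 * B k m"
      unfolding E_def B_def using test_gradient_inner_integrable[OF \<phi> \<phi>] by simp
    finally show ?thesis using m[OF that] \<epsilon> by (simp add: ennreal_le_iff)
  qed
  have g': "locally_integrable u" "g \<in> borel_measurable lebesgue"
    using g by (auto simp: is_weak_gradient_def intro: locally_integrable_measurable)
  have gsq: "integrable lebesgue (\<lambda>x. g x \<bullet> g x)" "(LINT x|lebesgue. g x \<bullet> g x) = W"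
  proof -
    have "has_bochner_integral lebesgue (\<lambda>x. g x \<bullet> g x) W"
      using W g'(2) by (intro has_bochner_integral_nn_integral) (auto simp: power2_norm_eq_inner)
    then show "integrable lebesgue (\<lambda>x. g x \<bullet> g x)" "(LINT x|lebesgue. g x \<bullet> g x) = W"
      by (auto simp: has_bochner_integral_iff)
  qed
  let ?d = "\<lambda>i. partial_deriv i (partial_deriv i (\<phi> m))"
  have d: "?d i \<in> test_functions \<Omega>" if "i \<in> Basis" for i
    by (intro test_partial_deriv that \<phi>)
  have leb: "integrable lebesgue (\<lambda>x. gradient (\<phi> k) x \<bullet> gradient (\<phi> m) x)"
      "(LINT x|lebesgue. gradient (\<phi> k) x \<bullet> gradient (\<phi> m) x) = B k m" for k
    using test_gradient_inner_integrable[OF \<phi>[of k] \<phi>[of m]]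
    by (simp_all add: B_def integrable_completion integral_completion)
  define P where "P = (LINT x|lebesgue. g x \<bullet> gradient (\<phi> m) x)"
  have "2 * P \<le> W + E m"
  proof -
    have "(LINT x|lebesgue. 2 * (g x \<bullet> gradient (\<phi> m) x)) \<le>
        (LINT x|lebesgue. g x \<bullet> g x + gradient (\<phi> m) x \<bullet> gradient (\<phi> m) x)"
    proof (rule integral_mono)
      show "2 * (g x \<bullet> gradient (\<phi> m) x) \<le> g x \<bullet> g x + gradient (\<phi> m) x \<bullet> gradient (\<phi> m) x" for x
        using inner_ge_zero[of "g x - gradient (\<phi> m) x"]
        by (simp add: inner_diff_left inner_diff_right inner_commute)
    qed (use weak_gradient_pairing(1)[OF g \<phi>] gsq leb in auto)
    then show ?thesis using gsq leb by (simp add: P_def E_def B_def)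
  qed
  have diff: "B k m - P = - (\<Sum>i\<in>Basis. LINT x|lebesgue. (\<phi> k x - u x) * ?d i x)" for k
  proof -
    have loc: "locally_integrable (\<phi> k)" by (rule continuous_locally_integrable[OF test_continuous[OF \<phi>]])
    have "(LINT x|lebesgue. (\<phi> k x - u x) * ?d i x) =
        (LINT x|lebesgue. \<phi> k x * ?d i x) - (LINT x|lebesgue. u x * ?d i x)" if "i \<in> Basis" for i
      using locally_integrable_mult_test[OF loc d[OF that]] locally_integrable_mult_test[OF g'(1) d[OF that]]
      by (simp add: left_diff_distrib)
    then have "(\<Sum>i\<in>Basis. LINT x|lebesgue. (\<phi> k x - u x) * ?d i x) =
        (\<Sum>i\<in>Basis. LINT x|lebesgue. \<phi> k x * ?d i x) - (\<Sum>i\<in>Basis. LINT x|lebesgue. u x * ?d i x)"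
      by (simp add: sum_subtractf)
    then show ?thesis
      using weak_gradient_pairing(2)[OF g \<phi>, of m]
        weak_gradient_pairing(2)[OF gradient_is_weak_gradient[OF \<phi>] \<phi>, of k m]
      by (simp add: leb P_def)
  qed
  have "(\<lambda>k. \<Sum>i\<in>Basis. LINT x|lebesgue. (\<phi> k x - u x) * ?d i x) \<longlonglongrightarrow> (\<Sum>i\<in>(Basis :: 'a set). 0)"
  proof (intro tendsto_sum)
    fix i :: 'a assume "i \<in> Basis"
    have "(\<lambda>x. \<phi> k x - u x) \<in> borel_measurable lebesgue" for k
      by (intro borel_measurable_diff locally_integrable_measurable[OF g'(1)]
          borel_measurable_lebesgue_if_borel[OF test_borel_measurable[OF \<phi>]])
    from pairing_tendsto_0[OF this lim p d[OF \<open>i \<in> Basis\<close>]]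
    show "(\<lambda>k. LINT x|lebesgue. (\<phi> k x - u x) * ?d i x) \<longlonglongrightarrow> 0" .
  qed
  then have "(\<lambda>k. B k m - P) \<longlonglongrightarrow> 0"
    unfolding diff using tendsto_minus by fastforce
  then have "\<forall>\<^sub>F k in sequentially. B k m - P < \<epsilon> / 4"
    using \<epsilon> by (intro order_tendstoD) auto
  with eventually_ge_at_top[of m] show ?thesis
  proof eventually_elim
    case (elim k)
    have "E k \<le> W + \<epsilon>" using polar[OF elim(1)] elim(2) \<open>2 * P \<le> W + E m\<close> by linarith
    then show ?case
      unfolding dirichlet_energy_eq_integral[OF \<phi>] E_def by (rule ennreal_leI)
  qed
qed

text \<open>
  Either \<open>b\<close> is at least \<open>(1 - t) \<bar>a\<bar>\<close> in absolute value, or the difference exceeds \<open>t \<bar>a\<bar>\<close>. Integrated, this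
  bounds the power integral of an approximating function from below: the coefficient of \<open>\<bar>b\<bar>\<^sup>p\<close> can be
  chosen near \<open>1\<close>, and the error term is small if the functions are close.
\<close>

lemma powr_norm_le_of_diff:
  fixes a b :: real
  assumes t: "0 < t" "t < 1" and p: "p > 0"
  shows "\<bar>a\<bar> powr p \<le> (1 - t) powr - p * \<bar>b\<bar> powr p + t powr - p * \<bar>b - a\<bar> powr p"
proof (cases "\<bar>b - a\<bar> \<le> t * \<bar>a\<bar>")
  case True
  then have "(1 - t) * \<bar>a\<bar> \<le> \<bar>b\<bar>" by (simp add: algebra_simps)
  then have "\<bar>a\<bar> powr p \<le> (\<bar>b\<bar> / (1 - t)) powr p"
    using t p by (intro powr_mono2) (auto simp: field_simps)
  also have "\<dots> = (1 - t) powr - p * \<bar>b\<bar> powr p" using t by (simp add: powr_divide powr_minus_divide)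
  finally show ?thesis by (simp add: add_increasing2)
next
  case False
  then have "\<bar>a\<bar> powr p \<le> (\<bar>b - a\<bar> / t) powr p"
    using t p by (intro powr_mono2) (auto simp: field_simps)
  also have "\<dots> = t powr - p * \<bar>b - a\<bar> powr p" using t by (simp add: powr_divide powr_minus_divide)
  finally show ?thesis by (simp add: add_increasing)
qed

lemma power_integral_eventually_ge:
  fixes u :: "'a::euclidean_space \<Rightarrow> real"
  assumes \<phi>: "\<And>k. \<phi> k \<in> test_functions \<Omega>" and u: "u \<in> borel_measurable lebesgue"
    and lim: "(\<lambda>k. Lp_norm p (\<lambda>x. \<phi> k x - u x)) \<longlonglongrightarrow> 0" and p: "p > 0"
    and one: "Lp_norm p u = 1" and t: "0 < t" "t < 1"
  shows "\<forall>\<^sub>F k in sequentially. (1 - t) powr (p + 1) \<le> (LINT x|lborel. \<bar>\<phi> k x\<bar> powr p)"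
proof -
  \<comment> \<open>The exponent is chosen such that the error term \<open>t powr - p * \<eta> powr p\<close> below equals \<open>t\<close>.\<close>
  define \<eta> where "\<eta> = t powr (1 + 1 / p)"
  have "\<forall>\<^sub>F k in sequentially. Lp_norm p (\<lambda>x. \<phi> k x - u x) < ennreal \<eta>"
    using lim t by (intro order_tendstoD) (auto simp: \<eta>_def)
  then show ?thesis
  proof eventually_elim
    case (elim k)
    let ?A = "LINT x|lborel. \<bar>\<phi> k x\<bar> powr p"
    have A: "?A \<ge> 0" by simp
    have int: "(\<integral>\<^sup>+x. ennreal (\<bar>\<phi> k x\<bar> powr p) \<partial>lebesgue) = ennreal ?A"
      using nn_integral_eq_integral[OF test_integrable_power[OF \<phi> p]] by (simp add: nn_integral_completion)
    have "(\<integral>\<^sup>+x. ennreal (\<bar>u x\<bar> powr p) \<partial>lebesgue) = 1"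
    proof (cases "\<integral>\<^sup>+x. ennreal (\<bar>u x\<bar> powr p) \<partial>lebesgue")
      case (real r)
      then have "r powr (1 / p) = 1" using one by (simp add: Lp_norm_def enn_powr_def)
      then have "(r powr (1 / p)) powr p = 1" by simp
      then show ?thesis using real p by (simp add: powr_powr)
    next
      case top
      then show ?thesis using one by (simp add: Lp_norm_def enn_powr_def)
    qed
    then have "1 = (\<integral>\<^sup>+x. ennreal (\<bar>u x\<bar> powr p) \<partial>lebesgue)" by simp
    also have "\<dots> \<le> (\<integral>\<^sup>+x. ennreal ((1 - t) powr - p) * ennreal (\<bar>\<phi> k x\<bar> powr p)
        + ennreal (t powr - p) * ennreal (norm (\<phi> k x - u x) powr p) \<partial>lebesgue)"
      using powr_norm_le_of_diff[OF t p]
      by (intro nn_integral_mono) (simp add: ennreal_leI flip: ennreal_mult' ennreal_plus)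
    also have "\<dots> = ennreal ((1 - t) powr - p) * ennreal ?A +
        ennreal (t powr - p) * (\<integral>\<^sup>+x. ennreal (norm (\<phi> k x - u x) powr p) \<partial>lebesgue)"
    proof -
      have [measurable]: "\<phi> k \<in> borel_measurable lebesgue" "u \<in> borel_measurable lebesgue"
        by (rule borel_measurable_lebesgue_if_borel[OF test_borel_measurable[OF \<phi>]] u)+
      have "(\<lambda>x. ennreal (\<bar>\<phi> k x\<bar> powr p)) \<in> borel_measurable lebesgue"
        "(\<lambda>x. ennreal (norm (\<phi> k x - u x) powr p)) \<in> borel_measurable lebesgue" by measurable
      then show ?thesis
        by (subst nn_integral_add) (simp_all add: nn_integral_cmult int[symmetric])
    qed
    also have "\<dots> \<le> ennreal ((1 - t) powr - p) * ennreal ?A + ennreal (t powr - p) * ennreal (\<eta> powr p)"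
      using p by (intro add_left_mono mult_left_mono nn_integral_le_if_Lp_norm_less[OF elim]) auto
    also have "\<dots> = ennreal ((1 - t) powr - p * ?A + t powr - p * \<eta> powr p)"
      using A by (simp flip: ennreal_mult' ennreal_plus)
    also have "t powr - p * \<eta> powr p = t"
      using t p by (simp add: \<eta>_def powr_powr distrib_right flip: powr_add)
    finally have "1 \<le> (1 - t) powr - p * ?A + t"
      unfolding ennreal_1[symmetric] using A t by (subst (asm) ennreal_le_iff) simp_all
    then have "(1 - t) powr p * (1 - t) \<le> (1 - t) powr p * ((1 - t) powr - p * ?A)"
      by (intro mult_left_mono) auto
    also have "\<dots> = ?A" using t by (simp add: powr_minus mult.assoc[symmetric])
    finally show ?case using t by (simp add: powr_add)
  qed
qed

section \<open>Functions of zero Gagliardo energy\<close>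

lemma AE_lborel_prod:
  assumes "AE x in (lborel :: 'a::euclidean_space measure). P x"
  shows "AE p in (lborel :: ('a \<times> 'a) measure). P (fst p) \<and> P (snd p)"
proof -
  obtain N where N: "{x. \<not> P x} \<subseteq> N" "emeasure lborel N = 0" "N \<in> sets lborel"
    using AE_E[OF assms] by auto
  have "N \<times> UNIV \<union> UNIV \<times> N \<in> null_sets (lborel \<Otimes>\<^sub>M lborel)"
  proof (intro null_sets.Un null_setsI)
    show "emeasure (lborel \<Otimes>\<^sub>M lborel) (N \<times> (UNIV :: 'a set)) = 0"
      using lborel.emeasure_pair_measure_Times[of N lborel UNIV] N by simp
    show "emeasure (lborel \<Otimes>\<^sub>M lborel) ((UNIV :: 'a set) \<times> N) = 0"
      using lborel.emeasure_pair_measure_Times[of UNIV lborel N] N by simp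
  qed (use N in \<open>auto intro: pair_measureI\<close>)
  then show ?thesis
    unfolding lborel_prod by (rule AE_I') (use N in auto)
qed

text \<open>
  If the double integral vanishes then \<open>u x = u y\<close> for almost every pair, and by Fubini some single \<open>x\<close>
  has this property for almost every \<open>y\<close>. Replacing \<open>u\<close> by a Borel version makes the integrand
  measurable for the product of the Borel-Lebesgue measures.
\<close>

lemma AE_const_if_gagliardo_energy_zero:
  fixes u :: "'a::euclidean_space \<Rightarrow> real"
  assumes u: "u \<in> borel_measurable lebesgue" and zero: "gagliardo_energy s u = 0"
  obtains c where "AE x in lborel. u x = c"
proof -
  let ?b = "real DIM('a) + 2 * s"
  obtain v where v[measurable]: "v \<in> borel_measurable lborel" and eq: "AE x in lborel. u x = v x"
    using completion_ex_borel_measurable_real[of u lborel] u by auto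
  let ?k = "\<lambda>p. ennreal (\<bar>v (fst p) - v (snd p)\<bar>\<^sup>2 / norm (fst p - snd p) powr ?b)"
  have "gagliardo_energy s u = (\<integral>\<^sup>+p. ?k p \<partial>lborel)"
    unfolding gagliardo_energy_def
    by (rule nn_integral_cong_AE) (use AE_lborel_prod[OF eq] in eventually_elim, auto split: prod.split)
  then have int: "(\<integral>\<^sup>+p. ?k p \<partial>lborel) = 0" using zero by simp
  have "?k \<in> borel_measurable (lborel \<Otimes>\<^sub>M lborel)" by measurable
  then have "?k \<in> borel_measurable lborel" unfolding lborel_prod .
  from iffD1[OF nn_integral_0_iff_AE[OF this] int]
  have "AE p in lborel \<Otimes>\<^sub>M lborel. v (fst p) = v (snd p)"
    unfolding lborel_prod by eventually_elim (auto simp: ennreal_eq_0_iff divide_le_0_iff)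
  from lborel_pair.AE_pair[OF this] have "AE x in lborel. AE y in lborel. v x = v y"
    by simp
  moreover have "ae_filter (lborel :: 'a measure) \<noteq> bot"
    by (simp add: trivial_limit_def[symmetric] ae_filter_eq_bot_iff)
  ultimately obtain x where "AE y in lborel. v x = v y"
    by (blast dest: eventually_happens')
  with eq have "AE y in lborel. u y = v x" by eventually_elim simp
  then show thesis by (rule that)
qed

text \<open>
  The whole space has infinite measure, so the norm of a constant is \<open>0\<close> or \<open>\<infinity>\<close>.
\<close>

lemma Lp_norm_AE_const_neq_1:
  fixes u :: "'a::euclidean_space \<Rightarrow> real"
  assumes "AE x in lborel. u x = c" and "p > 0"
  shows "Lp_norm p u \<noteq> 1"
proof -
  have "(\<integral>\<^sup>+x. ennreal (norm (u x) powr p) \<partial>lebesgue) = (\<integral>\<^sup>+x. ennreal (\<bar>c\<bar> powr p) \<partial>(lborel :: 'a measure))"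
    unfolding nn_integral_completion by (rule nn_integral_cong_AE) (use assms(1) in eventually_elim, simp)
  also have "\<dots> = ennreal (\<bar>c\<bar> powr p) * \<infinity>" by simp
  finally show ?thesis
    using assms(2) by (cases "c = 0") (auto simp: Lp_norm_def enn_powr_def ennreal_mult_top)
qed

section \<open>Non-attainment\<close>

text \<open>
  Let \<open>W\<close> be the squared gradient norm of a minimiser. The approximating test functions have Dirichlet
  quotients with upper limit at most \<open>W\<close>, so the scaling estimate bounds the constant by \<open>W\<close>.
  Minimality says that the constant is \<open>W\<close> plus the Gagliardo energy, which therefore vanishes.
\<close>

lemma sobolev_const_not_attained:
  fixes u :: "'a::euclidean_space \<Rightarrow> real" and \<Omega> :: "'a set"
  assumes dim: "DIM('a) \<ge> 3" and s: "0 < s" "s < 1" and \<Omega>: "open \<Omega>" "\<Omega> \<noteq> {}"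
    and u: "u \<in> X12 s \<Omega>" and one: "Lp_norm (crit_exp DIM('a)) u = 1"
  shows "(rho s u)\<^sup>2 \<noteq> sobolev_const s \<Omega>"
proof
  assume min: "(rho s u)\<^sup>2 = sobolev_const s \<Omega>"
  define p where "p = crit_exp DIM('a)"
  have p: "p \<ge> 1" using dim by (simp add: p_def crit_exp_def divide_simps)
  have um: "u \<in> borel_measurable lebesgue" using u by (simp add: X12_def)
  obtain \<phi> where \<phi>: "\<And>k. \<phi> k \<in> test_functions \<Omega>"
    and Cauchy: "\<And>\<epsilon>. \<epsilon> > 0 \<Longrightarrow> \<exists>N. \<forall>k\<ge>N. \<forall>m\<ge>N. rho s (\<lambda>x. \<phi> k x - \<phi> m x) < ennreal \<epsilon>"
    and lim: "(\<lambda>k. Lp_norm p (\<lambda>x. \<phi> k x - u x)) \<longlonglongrightarrow> 0"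
    using u unfolding X12_def p_def by auto
  define A where "A k = (LINT x|lborel. \<bar>\<phi> k x\<bar> powr p)" for k
  have A: "(\<integral>\<^sup>+x. ennreal (\<bar>\<phi> k x\<bar> powr p) \<partial>lborel) = ennreal (A k)" for k
    unfolding A_def using p by (intro nn_integral_eq_integral test_integrable_power[OF \<phi>]) auto
  have A_ge: "\<forall>\<^sub>F k in sequentially. (1 - t) powr (p + 1) \<le> A k" if "0 < t" "t < 1" for t
    unfolding A_def using p by (intro power_integral_eventually_ge[OF \<phi> um lim _ one[folded p_def] that]) simp
  have quotient: "sobolev_const s \<Omega> \<le> ennreal (a powr (- 2 / p) * e)"
    if ae: "0 < a" "a \<le> A k" "dirichlet_energy (\<phi> k) \<le> ennreal e" "0 \<le> e" for a e k
  proof -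
    obtain E where E: "dirichlet_energy (\<phi> k) = ennreal E" "E \<ge> 0" "E \<le> e"
      using ae(3,4) by (cases "dirichlet_energy (\<phi> k)") (auto simp: top_unique)
    have "sobolev_const s \<Omega> \<le> ennreal (A k powr (- 2 / p) * E)"
      using sobolev_const_le_dirichlet_quotient[OF dim s \<Omega> test_UNIV[OF \<phi>] A[unfolded p_def] _ E(1,2)] ae
      by (simp add: p_def)
    also have "\<dots> \<le> ennreal (a powr (- 2 / p) * e)"
      using ae E p by (intro ennreal_leI mult_mono powr_mono2') auto
    finally show ?thesis .
  qed
  \<comment> \<open>Finiteness of the constant rules out that a minimiser has infinite energy, and allows the
    final cancellation of \<open>W\<close>.\<close>
  have "sobolev_const s \<Omega> < \<infinity>"
  proof -
    obtain k where k: "(1 - 1 / 2) powr (p + 1) \<le> A k"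
      using eventually_happens'[OF sequentially_bot A_ge[of "1 / 2"]] by auto
    have "sobolev_const s \<Omega> \<le> ennreal (((1 - 1 / 2) powr (p + 1)) powr (- 2 / p) *
        (LINT x|lborel. gradient (\<phi> k) x \<bullet> gradient (\<phi> k) x))"
      by (rule quotient[OF _ k]) (simp_all add: dirichlet_energy_eq_integral[OF \<phi>])
    then show ?thesis by (rule le_less_trans) simp
  qed
  then have fin: "(gradient_norm u)\<^sup>2 + gagliardo_energy s u < \<infinity>"
    by (simp add: min[symmetric] rho_def enn_powr_half_square gagliardo_seminorm_square)
  then have gn: "gradient_norm u \<noteq> \<infinity>" by (auto simp: power2_eq_square)
  define g where "g = weak_gradient u"
  have g: "is_weak_gradient u g" and gn': "gradient_norm u = Lp_norm 2 g"
    using gn someI_ex[of "is_weak_gradient u"]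
    by (auto simp: g_def weak_gradient_def gradient_norm_def split: if_splits)
  have gsq: "(gradient_norm u)\<^sup>2 = (\<integral>\<^sup>+x. ennreal ((norm (g x))\<^sup>2) \<partial>lebesgue)"
    by (simp add: gn' Lp_norm_def enn_powr_half_square powr_numeral)
  obtain W where W: "(gradient_norm u)\<^sup>2 = ennreal W" "W \<ge> 0"
    using fin by (cases "(gradient_norm u)\<^sup>2") auto
  have Cauchy': "\<exists>N. \<forall>k\<ge>N. \<forall>m\<ge>N. dirichlet_energy (\<lambda>x. \<phi> k x - \<phi> m x) \<le> ennreal \<epsilon>"
    if \<epsilon>: "\<epsilon> > 0" for \<epsilon>
  proof -
    have "dirichlet_energy (\<lambda>x. \<phi> k x - \<phi> m x) \<le> ennreal \<epsilon>"
      if "rho s (\<lambda>x. \<phi> k x - \<phi> m x) < ennreal (sqrt \<epsilon>)" for k m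
    proof -
      have "dirichlet_energy (\<lambda>x. \<phi> k x - \<phi> m x) \<le> (rho s (\<lambda>x. \<phi> k x - \<phi> m x))\<^sup>2"
        unfolding rho_square_test[OF test_diff[OF \<phi> \<phi>]] by simp
      also have "\<dots> \<le> (ennreal (sqrt \<epsilon>))\<^sup>2" using that by (intro power_mono) auto
      also have "\<dots> = ennreal \<epsilon>" using \<epsilon> by (simp add: ennreal_power)
      finally show ?thesis .
    qed
    with Cauchy[of "sqrt \<epsilon>"] \<epsilon> show ?thesis by fastforce
  qed
  have "sobolev_const s \<Omega> \<le> ennreal (((1 - t) powr (p + 1)) powr (- 2 / p) * (W + t))"
    if t: "0 < t" "t < 1" for t
  proof -
    have "\<forall>\<^sub>F k in sequentially. dirichlet_energy (\<phi> k) \<le> ennreal (W + t)"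
      by (rule dirichlet_energy_eventually_le[OF \<phi> g lim p Cauchy' W[unfolded gsq] t(1)])
    with A_ge[OF t]
    have "\<forall>\<^sub>F k in sequentially. (1 - t) powr (p + 1) \<le> A k \<and> dirichlet_energy (\<phi> k) \<le> ennreal (W + t)"
      by (rule eventually_conj)
    then obtain k where "(1 - t) powr (p + 1) \<le> A k" "dirichlet_energy (\<phi> k) \<le> ennreal (W + t)"
      using eventually_happens'[OF sequentially_bot] by blast
    then show ?thesis using t W(2) by (intro quotient) auto
  qed
  then have ev: "\<forall>\<^sub>F t in at_right 0. sobolev_const s \<Omega> \<le> ennreal (((1 - t) powr (p + 1)) powr (- 2 / p) * (W + t))"
    by (auto simp: eventually_at_right_field intro!: exI[of _ 1])
  have "((\<lambda>t. ennreal (((1 - t) powr (p + 1)) powr (- 2 / p) * (W + t))) \<longlongrightarrow>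
      ennreal (((1 - 0) powr (p + 1)) powr (- 2 / p) * (W + 0))) (at_right 0)"
    by (intro tendsto_intros) auto
  from tendsto_lowerbound[OF this ev] have "sobolev_const s \<Omega> \<le> ennreal W" by simp
  then have "(gradient_norm u)\<^sup>2 + gagliardo_energy s u \<le> (gradient_norm u)\<^sup>2 + 0"
    using W by (simp add: min[symmetric] rho_def enn_powr_half_square gagliardo_seminorm_square)
  then have "gagliardo_energy s u = 0"
    using W(1) by (simp add: ennreal_add_left_cancel_le)
  then obtain c where "AE x in lborel. u x = c"
    using AE_const_if_gagliardo_energy_zero[OF um] by blast
  then show False using Lp_norm_AE_const_neq_1[of u c p] one p by (simp add: p_def)
qed

theorem theorem1p2:
  fixes \<Omega> :: "(real ^ 'n) set" and s :: real
  assumes "CARD('n) \<ge> 3"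
    and "0 < s" and "s < 1"
    and "open \<Omega>" and "\<Omega> \<noteq> {}"
  shows "\<not> (\<exists>u \<in> X12 s \<Omega>.
              Lp_norm (crit_exp CARD('n)) u = 1 \<and> (rho s u)\<^sup>2 = sobolev_const s \<Omega>)"
  using sobolev_const_not_attained[of s \<Omega>] assms by auto

end
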